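(* For each $t \in \mathbb{N}$ there exists $\tilde{C}_t > 0$ such that for every $n \geq t$ and every $\mathcal{A} \subset S_n$ with $|\mathcal{A}| \leq (n-t+1)!$, $$|\partial \mathcal{A}| \geq \left(1 - \tilde{C}_t\,\frac{|\mathcal{A}|}{(n-t+1)!}\right) t(n-t+1)\,|\mathcal{A}|.$$
   Context: The transposition graph on $S_n$ is the Cayley graph with vertex set $S_n$ in which $\sigma$ and $\pi$ are adjacent iff $\sigma\pi^{-1}$ is a transposition. For $\mathcal{A} \subset S_n$, $\partial \mathcal{A}$ is the set of edges of the transposition graph with one endpoint in $\mathcal{A}$ and the other in $S_n \setminus \mathcal{A}$. *)

theory Defs
  imports Complex_Main "HOL-Combinatorics.Permutations"
begin

definition Sym :: "nat \<Rightarrow> (nat \<Rightarrow> nat) set" where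
  "Sym n = {\<sigma>. \<sigma> permutes {1..n}}"

definition is_transposition :: "nat \<Rightarrow> (nat \<Rightarrow> nat) \<Rightarrow> bool" where
  "is_transposition n \<tau> \<longleftrightarrow>
     (\<exists>a\<in>{1..n}. \<exists>b\<in>{1..n}. a \<noteq> b \<and> \<tau> = transpose a b)"

text \<open>Edges are undirected, represented as two-element sets of permutations.\<close>

definition transposition_graph_edges :: "nat \<Rightarrow> (nat \<Rightarrow> nat) set set" where
  "transposition_graph_edges n =
     {{\<sigma>, \<pi>} | \<sigma> \<pi>. \<sigma> \<in> Sym n \<and> \<pi> \<in> Sym n \<and> is_transposition n (\<sigma> \<circ> inv \<pi>)}"

definition edge_boundary :: "nat \<Rightarrow> (nat \<Rightarrow> nat) set \<Rightarrow> (nat \<Rightarrow> nat) set set" where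
  "edge_boundary n A =
     {e \<in> transposition_graph_edges n. \<exists>\<sigma>\<in>A. \<exists>\<pi>\<in>Sym n - A. e = {\<sigma>, \<pi>}}"

end

theory Submission
  imports Defs "HOL-Analysis.Function_Topology"
begin

text \<open>
  Write \<open>f\<close> for the indicator function of \<open>A\<close> and let \<open>S\<^sub>n\<close> act on real functions on \<open>S\<^sub>n\<close> by right
  translation. The boundary of \<open>A\<close> is the quadratic form of the Laplacian \<open>L\<close> at \<open>f\<close>, and
  for \<open>n \<ge> 3t\<close> we have \<open>\<langle>f, L f\<rangle> \<ge> t(n-t+1) (\<langle>f, f\<rangle> - \<Sum>\<langle>f, E\<^sub>X f\<rangle>)\<close>, where \<open>X\<close> ranges over the
  \<open>(n-t+1)\<close>-subsets and \<open>E\<^sub>X\<close> averages over the permutations of \<open>X\<close>. This needs no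
  representation theory: take an eigenvector \<open>u\<close> for the least eigenvalue of the difference of both
  sides. If some \<open>E\<^sub>X\<close> does not kill it, then \<open>v = E\<^sub>X u\<close> already contributes \<open>\<langle>v, v\<rangle>\<close> to the sum.
  Otherwise choose \<open>Y\<close> of maximal size \<open>j \<le> n-t\<close> such that \<open>v = E\<^sub>Y u\<close> is nonzero; since \<open>v\<close> is killed by
  averaging over \<open>Y \<union> {b}\<close>, the transpositions between \<open>Y\<close> and \<open>b\<close> sum to \<open>-1\<close> on \<open>v\<close>, so that
  \<open>L v = (j+1)(n-j) v + L' v\<close> with \<open>L'\<close> the Laplacian of the complement of \<open>Y\<close>.
  For small \<open>j\<close>, where \<open>(j+1)(n-j)\<close> is too small, iterating this on the complement gives at least \<open>n(n-j)/2\<close>.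

  The sum of the \<open>\<langle>f, E\<^sub>X f\<rangle>\<close> is \<open>1/(n-t+1)!\<close> times the sum over \<open>\<sigma>, \<rho> \<in> A\<close> of
  \<open>agree(\<sigma>, \<rho>) choose (t-1)\<close>. It is of order \<open>|A|\<^sup>2/(n-t+1)!\<close> as soon as \<open>|A| \<ge> n!/n\<^sup>u\<close> for a fixed \<open>u\<close>, by
  an exponential moment estimate (for \<open>t = 2\<close>) and induction on \<open>t\<close>. For smaller \<open>A\<close> the spectral bound with
  \<open>t + 1\<close> in place of \<open>t\<close> suffices, and small \<open>n\<close> are absorbed into the constant.
\<close>

section \<open>Least eigenvalues of self-adjoint operators\<close>

definition dot :: "'a set \<Rightarrow> ('a \<Rightarrow> real) \<Rightarrow> ('a \<Rightarrow> real) \<Rightarrow> real" where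
  "dot S f g = (\<Sum>x\<in>S. f x * g x)"

lemma dot_commute: "dot S f g = dot S g f"
  by (simp add: dot_def mult.commute)

lemma dot_add_right: "dot S f (\<lambda>x. g x + c * h x) = dot S f g + c * dot S f h"
  by (simp add: dot_def algebra_simps sum.distrib sum_distrib_left)

lemma dot_add_left: "dot S (\<lambda>x. g x + c * h x) f = dot S g f + c * dot S h f"
  by (simp add: dot_def algebra_simps sum.distrib sum_distrib_left)

lemma dot_cong:
  "(\<And>x. x \<in> S \<Longrightarrow> f x = f' x) \<Longrightarrow> (\<And>x. x \<in> S \<Longrightarrow> g x = g' x) \<Longrightarrow> dot S f g = dot S f' g'"
  by (simp add: dot_def)

lemma dot_self_nonneg: "dot S f f \<ge> 0"
  by (simp add: dot_def sum_nonneg)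

lemma dot_self_eq_0_iff: "finite S \<Longrightarrow> dot S f f = 0 \<longleftrightarrow> (\<forall>x\<in>S. f x = 0)"
  by (simp add: dot_def sum_nonneg_eq_0_iff)

text \<open>If \<open>a\<close> were nonzero, the linear term would beat the quadratic one at
  \<open>e = - a / c\<close> with \<open>c > 0\<close> and \<open>2 * c > b\<close>. This is the
  first variation at a minimizer.\<close>

lemma nonneg_quadratic_imp_linear_coeff_0:
  fixes a b :: real
  assumes "\<And>e. 2 * e * a + e\<^sup>2 * b \<ge> 0"
  shows "a = 0"
proof (rule ccontr)
  assume "a \<noteq> 0"
  define c where "c = \<bar>b\<bar> + 1"
  have "c > 0" "b < 2 * c" by (auto simp: c_def)
  then have "2 * (- a / c) * a + (- a / c)\<^sup>2 * b = (a\<^sup>2 / c\<^sup>2) * (b - 2 * c)"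
    by (simp add: field_simps power2_eq_square)
  also have "\<dots> < 0"
    using \<open>a \<noteq> 0\<close> \<open>c > 0\<close> \<open>b < 2 * c\<close> by (intro mult_pos_neg) auto
  finally show False
    using assms[of "- a / c"] by simp
qed

text \<open>Functions on the whole type carry the product topology, so Tychonoff applies: a closed
  condition is imposed on a product of copies of \<open>{-1..1}\<close> and \<open>{0}\<close>.
  Pinning the values outside \<open>S\<close> to 0 keeps every coordinate in a compact set.\<close>

lemma compact_supported_unit_sphere:
  assumes "finite S"
  shows "compact {f :: 'a \<Rightarrow> real. (\<forall>x. x \<notin> S \<longrightarrow> f x = 0) \<and> dot S f f = 1}" (is "compact ?K")
proof -
  let ?P = "PiE UNIV (\<lambda>x. if x \<in> S then {-1..1} else {0 :: real})"
  have "compactin (product_topology (\<lambda>_. euclidean) UNIV) ?P"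
    by (simp add: compactin_PiE)
  then have P: "compact ?P"
    by (simp add: euclidean_product_topology)
  have "closed {f :: 'a \<Rightarrow> real. dot S f f = 1}"
    unfolding dot_def by (intro closed_Collect_eq continuous_intros) auto
  moreover have "?K = ?P \<inter> {f. dot S f f = 1}"
  proof (intro equalityI subsetI)
    fix f assume f: "f \<in> ?K"
    have "\<bar>f x\<bar> \<le> 1" if "x \<in> S" for x
    proof -
      have "f x * f x \<le> dot S f f"
        unfolding dot_def using that assms by (intro member_le_sum) auto
      then show ?thesis
        using f by (simp add: abs_square_le_1 flip: power2_eq_square)
    qed
    then show "f \<in> ?P \<inter> {f. dot S f f = 1}"
      using f by (auto simp: PiE_iff abs_le_iff minus_le_iff)
  next
    fix f assume "f \<in> ?P \<inter> {f. dot S f f = 1}"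
    then have P: "f \<in> ?P" and 1: "dot S f f = 1"
      by simp_all
    have "f x = 0" if "x \<notin> S" for x
      using PiE_mem[OF P UNIV_I, of x] that by simp
    with 1 show "f \<in> ?K"
      by simp
  qed
  ultimately show ?thesis
    using P by (simp add: compact_Int_closed)
qed

text \<open>Locality and linearity turn \<open>T f x\<close> into a finite linear combination of the
  coordinates \<open>f y\<close> with \<open>y\<close> in \<open>S\<close>, and coordinates are
  continuous.\<close>

lemma linear_operator_continuous:
  fixes T :: "('a \<Rightarrow> real) \<Rightarrow> 'a \<Rightarrow> real"
  assumes "finite S" "x \<in> S"
    and linear: "\<And>f g c. T (\<lambda>x. f x + c * g x) = (\<lambda>x. T f x + c * T g x)"
    and local: "\<And>f g x. (\<And>y. y \<in> S \<Longrightarrow> f y = g y) \<Longrightarrow> x \<in> S \<Longrightarrow> T f x = T g x"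
  shows "continuous_on UNIV (\<lambda>f. T f x)"
proof -
  have zero: "T (\<lambda>x. 0) = (\<lambda>x. 0)"
    using linear[of "\<lambda>x. 0" "-1" "\<lambda>x. 0"] by simp
  have expand: "T (\<lambda>x. \<Sum>y\<in>F. f y * of_bool (x = y)) = (\<lambda>x. \<Sum>y\<in>F. f y * T (\<lambda>x. of_bool (x = y)) x)"
    if "finite F" for F f
    using that
  proof (induction F rule: finite_induct)
    case (insert z F)
    then show ?case
      using linear[of "\<lambda>x. \<Sum>y\<in>F. f y * of_bool (x = y)" "f z" "\<lambda>x. of_bool (x = z)"]
      by (simp add: add.commute del: sum_mult_of_bool_eq)
  qed (simp add: zero)
  have eq: "T f x = (\<Sum>y\<in>S. f y * T (\<lambda>x. of_bool (x = y)) x)" for f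
  proof -
    have "T f x = T (\<lambda>x. \<Sum>y\<in>S. f y * of_bool (x = y)) x"
    proof (rule local)
      fix z assume "z \<in> S"
      then have "S \<inter> {y. z = y} = {z}" by auto
      with \<open>finite S\<close> show "f z = (\<Sum>y\<in>S. f y * of_bool (z = y))"
        by simp
    qed fact
    then show ?thesis
      by (simp only: expand[OF \<open>finite S\<close>, of f])
  qed
  have "continuous_on UNIV (\<lambda>f. \<Sum>y\<in>S. f y * T (\<lambda>x. of_bool (x = y)) x)"
    by (intro continuous_on_sum continuous_on_mult_right continuous_on_product_coordinates)
  then show ?thesis
    by (rule continuous_on_eq) (rule eq[symmetric])
qed

text \<open>The quadratic form attains its minimum \<mu> on the compact unit sphere, and the
  vanishing first variation there is the eigenvector equation. Only values on \<open>S\<close> enter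
  \<open>dot\<close>, hence the locality assumption and the equation on \<open>S\<close>
  alone.\<close>

lemma rayleigh_minimizer:
  fixes T :: "('a \<Rightarrow> real) \<Rightarrow> 'a \<Rightarrow> real"
  assumes "finite S" "S \<noteq> {}"
    and linear: "\<And>f g c. T (\<lambda>x. f x + c * g x) = (\<lambda>x. T f x + c * T g x)"
    and local: "\<And>f g x. (\<And>y. y \<in> S \<Longrightarrow> f y = g y) \<Longrightarrow> x \<in> S \<Longrightarrow> T f x = T g x"
    and selfadjoint: "\<And>f g. dot S (T f) g = dot S f (T g)"
  obtains f \<mu> where "dot S f f = 1" "\<And>x. x \<in> S \<Longrightarrow> T f x = \<mu> * f x"
    "\<And>h. dot S h (T h) \<ge> \<mu> * dot S h h"
proof -
  let ?K = "{f :: 'a \<Rightarrow> real. (\<forall>x. x \<notin> S \<longrightarrow> f x = 0) \<and> dot S f f = 1}"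
  obtain x0 where "x0 \<in> S" using assms by blast
  then have "(\<lambda>x. of_bool (x = x0)) \<in> ?K"
    using \<open>finite S\<close> by (auto simp: dot_def)
  then have "?K \<noteq> {}"
    by (rule ex_in_conv[THEN iffD1, OF exI])
  moreover have "continuous_on ?K (\<lambda>f. \<Sum>x\<in>S. f x * T f x)"
  proof (intro continuous_on_sum continuous_on_mult)
    fix x assume "x \<in> S"
    show "continuous_on ?K (\<lambda>f. f x)"
      by (rule continuous_on_subset[OF continuous_on_product_coordinates subset_UNIV])
    have "continuous_on UNIV (\<lambda>f. T f x)"
      using \<open>finite S\<close> \<open>x \<in> S\<close> linear local by (rule linear_operator_continuous)
    then show "continuous_on ?K (\<lambda>f. T f x)"
      by (rule continuous_on_subset) (rule subset_UNIV)
  qed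
  ultimately have "\<exists>f\<in>?K. \<forall>g\<in>?K. (\<Sum>x\<in>S. f x * T f x) \<le> (\<Sum>x\<in>S. g x * T g x)"
    by (rule continuous_attains_inf[OF compact_supported_unit_sphere[OF \<open>finite S\<close>]])
  then obtain f where f: "f \<in> ?K" and min: "\<And>g. g \<in> ?K \<Longrightarrow> dot S f (T f) \<le> dot S g (T g)"
    unfolding dot_def[of _ _ "T _"] by blast
  define \<mu> where "\<mu> = dot S f (T f)"
  have lower: "dot S h (T h) \<ge> \<mu> * dot S h h" for h
  proof (cases "dot S h h = 0")
    case True
    then have "dot S h (T h) = 0"
      using \<open>finite S\<close> by (simp add: dot_self_eq_0_iff) (simp add: dot_def)
    with True show ?thesis by simp
  next
    case False
    then have pos: "dot S h h > 0"
      using dot_self_nonneg[of S h] by simp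
    define c where "c = 1 / sqrt (dot S h h)"
    have c2: "c * c = 1 / dot S h h"
      using pos by (simp add: c_def)
    \<comment> \<open>Normalised and cut off outside \<open>S\<close> so as to lie in
      \<open>?K\<close>; by locality the cut does not affect \<open>T\<close> on
      \<open>S\<close>.\<close>
    define g where "g = (\<lambda>x. if x \<in> S then c * h x else 0)"
    have Tg: "T g x = c * T h x" if "x \<in> S" for x
    proof -
      have "T g x = T (\<lambda>x. 0 + c * h x) x"
        using that by (intro local) (auto simp: g_def)
      also have "\<dots> = T (\<lambda>x. 0) x + c * T h x"
        by (simp only: linear)
      also have "T (\<lambda>x. 0) x = 0"
        using linear[of "\<lambda>x. 0" "-1" "\<lambda>x. 0"] by simp
      finally show ?thesis by simp
    qed
    have "dot S g g = c * c * dot S h h"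
      by (simp add: dot_def g_def sum_distrib_left mult_ac)
    then have "g \<in> ?K"
      using pos c2 by (simp add: g_def)
    from min[OF this] have "\<mu> \<le> dot S g (T g)"
      by (simp add: \<mu>_def)
    also have "dot S g (T g) = dot S (\<lambda>x. c * h x) (\<lambda>x. c * T h x)"
      by (rule dot_cong) (simp add: g_def, rule Tg)
    also have "\<dots> = c * c * dot S h (T h)"
      by (simp add: dot_def sum_distrib_left mult_ac)
    finally show ?thesis
      using pos by (simp add: c2 field_simps)
  qed
  \<comment> \<open>The form of \<open>T - \<mu>\<close> is nonnegative and vanishes at
    \<open>f\<close>, so its linear term in every direction \<open>h\<close> is 0.\<close>
  have orth: "dot S h (\<lambda>x. T f x + (- \<mu>) * f x) = 0" for h
  proof (rule nonneg_quadratic_imp_linear_coeff_0)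
    fix e :: real
    let ?g = "\<lambda>x. f x + e * h x"
    have 1: "dot S ?g (T ?g) = dot S f (T f) + 2 * e * dot S h (T f) + e\<^sup>2 * dot S h (T h)"
      unfolding linear dot_add_left dot_add_right selfadjoint[symmetric, of f h] dot_commute[of S "T f" h]
      by (simp add: power2_eq_square algebra_simps)
    have 2: "dot S ?g ?g = dot S f f + 2 * e * dot S h f + e\<^sup>2 * dot S h h"
      unfolding dot_add_left dot_add_right dot_commute[of S f h]
      by (simp add: power2_eq_square algebra_simps)
    have "2 * e * dot S h (\<lambda>x. T f x + (- \<mu>) * f x) + e\<^sup>2 * (dot S h (T h) - \<mu> * dot S h h)
        = dot S ?g (T ?g) - \<mu> * dot S ?g ?g"
      unfolding 1 2 unfolding dot_add_right using f by (simp add: \<mu>_def algebra_simps)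
    also have "\<dots> \<ge> 0"
      using lower[of ?g] by simp
    finally show "2 * e * dot S h (\<lambda>x. T f x + (- \<mu>) * f x)
        + e\<^sup>2 * (dot S h (T h) - \<mu> * dot S h h) \<ge> 0" .
  qed
  \<comment> \<open>Take the residual \<open>T f - \<mu> f\<close> itself as the direction.\<close>
  have eigen: "T f x = \<mu> * f x" if "x \<in> S" for x
    using orth[of "\<lambda>x. T f x + (- \<mu>) * f x"] that
    unfolding dot_self_eq_0_iff[OF \<open>finite S\<close>] by simp
  have "dot S f f = 1"
    using f by simp
  then show ?thesis
    using eigen lower by (rule that)
qed

section \<open>The Laplacian of the transposition graph\<close>

definition shift :: "('a \<Rightarrow> 'a) \<Rightarrow> (('a \<Rightarrow> 'a) \<Rightarrow> real) \<Rightarrow> ('a \<Rightarrow> 'a) \<Rightarrow> real" where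
  "shift \<pi> f = (\<lambda>\<sigma>. f (\<sigma> \<circ> \<pi>))"

text \<open>For finite \<open>X\<close> this is the projection \<open>E\<^sub>X\<close> onto the
  functions invariant under right multiplication by permutations of \<open>X\<close>.\<close>

definition avg :: "'a set \<Rightarrow> (('a \<Rightarrow> 'a) \<Rightarrow> real) \<Rightarrow> ('a \<Rightarrow> 'a) \<Rightarrow> real" where
  "avg X f = (\<lambda>\<sigma>. (\<Sum>\<pi> | \<pi> permutes X. f (\<sigma> \<circ> \<pi>)) / fact (card X))"

text \<open>The sum over ordered pairs meets each transposition twice, hence the division by 2; the
  diagonal contributes 0 because \<open>transpose a a\<close> is the identity.\<close>

definition laplacian :: "'a set \<Rightarrow> (('a \<Rightarrow> 'a) \<Rightarrow> real) \<Rightarrow> ('a \<Rightarrow> 'a) \<Rightarrow> real" where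
  "laplacian D f = (\<lambda>\<sigma>. (\<Sum>a\<in>D. \<Sum>b\<in>D. f \<sigma> - f (\<sigma> \<circ> transpose a b)) / 2)"

lemma shift_shift: "shift \<rho> (shift \<pi> f) = shift (\<rho> \<circ> \<pi>) f"
  by (simp add: shift_def o_assoc)

lemma avg_alt: "avg X f \<sigma> = (\<Sum>\<pi> | \<pi> permutes X. shift \<pi> f \<sigma>) / fact (card X)"
  by (simp add: avg_def shift_def)

lemma avg_linear: "avg X (\<lambda>\<sigma>. f \<sigma> + c * g \<sigma>) = (\<lambda>\<sigma>. avg X f \<sigma> + c * avg X g \<sigma>)"
  by (simp add: avg_def sum.distrib sum_distrib_left add_divide_distrib)

lemma laplacian_linear:
  "laplacian D (\<lambda>\<sigma>. f \<sigma> + c * g \<sigma>) = (\<lambda>\<sigma>. laplacian D f \<sigma> + c * laplacian D g \<sigma>)"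
proof
  fix \<sigma>
  have "(\<Sum>a\<in>D. \<Sum>b\<in>D. (f \<sigma> + c * g \<sigma>) - (f (\<sigma> \<circ> transpose a b) + c * g (\<sigma> \<circ> transpose a b)))
      = (\<Sum>a\<in>D. \<Sum>b\<in>D. (f \<sigma> - f (\<sigma> \<circ> transpose a b)) + c * (g \<sigma> - g (\<sigma> \<circ> transpose a b)))"
    by (simp add: algebra_simps)
  then show "laplacian D (\<lambda>\<sigma>. f \<sigma> + c * g \<sigma>) \<sigma> = laplacian D f \<sigma> + c * laplacian D g \<sigma>"
    by (simp add: laplacian_def sum.distrib add_divide_distrib flip: sum_distrib_left)
qed

lemma shift_avg: "\<pi> permutes X \<Longrightarrow> shift \<pi> (avg X f) = avg X f"
  using setum_permutations_compose_left[of \<pi> X "\<lambda>\<rho>. f (_ \<circ> \<rho>)"]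
  by (simp add: avg_def shift_def o_assoc)

lemma avg_invariant:
  assumes "finite X" "\<And>\<pi>. \<pi> permutes X \<Longrightarrow> shift \<pi> f = f"
  shows "avg X f = f"
proof
  fix \<sigma>
  have "(\<Sum>\<pi> | \<pi> permutes X. shift \<pi> f \<sigma>) = (\<Sum>\<pi> | \<pi> permutes X. f \<sigma>)"
    using assms by (intro sum.cong) simp_all
  then show "avg X f \<sigma> = f \<sigma>"
    using assms(1) by (simp add: avg_alt card_permutations[OF refl])
qed

lemma avg_avg_subset:
  assumes "Y \<subseteq> X" "finite X"
  shows "avg Y (avg X f) = avg X f"
  using assms by (intro avg_invariant shift_avg) (auto intro: finite_subset permutes_subset)

lemma avg_sum_divide:
  "avg X (\<lambda>\<sigma>. (\<Sum>i\<in>I. g i \<sigma>) / c) \<sigma> = (\<Sum>i\<in>I. avg X (g i) \<sigma>) / c"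
proof -
  have "(\<Sum>\<pi> | \<pi> permutes X. (\<Sum>i\<in>I. g i (\<sigma> \<circ> \<pi>)) / c) / fact (card X)
      = (\<Sum>\<pi> | \<pi> permutes X. \<Sum>i\<in>I. g i (\<sigma> \<circ> \<pi>)) / fact (card X) / c"
    by (simp add: sum_divide_distrib mult.commute)
  also have "(\<Sum>\<pi> | \<pi> permutes X. \<Sum>i\<in>I. g i (\<sigma> \<circ> \<pi>)) = (\<Sum>i\<in>I. \<Sum>\<pi> | \<pi> permutes X. g i (\<sigma> \<circ> \<pi>))"
    by (rule sum.swap)
  finally show ?thesis
    unfolding avg_def by (simp only: sum_divide_distrib)
qed

lemma avg_avg: "avg X (avg Y f) \<sigma> = (\<Sum>\<pi> | \<pi> permutes Y. avg X (shift \<pi> f) \<sigma>) / fact (card Y)"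
  unfolding avg_alt[of Y, abs_def] by (rule avg_sum_divide)

lemma permutes_if_bij: "bij p \<Longrightarrow> (\<And>x. x \<notin> S \<Longrightarrow> p x = x) \<Longrightarrow> p permutes S"
  by (simp add: permutes_def bij_iff)

lemma shift_avg_conj:
  assumes "bij \<pi>"
  shows "shift \<pi> (avg X f) = avg (\<pi> ` X) (shift \<pi> f)"
proof
  fix \<sigma>
  have inv: "\<pi> \<circ> inv \<pi> = id" "inv \<pi> \<circ> \<pi> = id"
    using assms by (simp_all add: bij_is_surj bij_is_inj flip: surj_iff)
  have conj: "\<pi> \<circ> \<rho> \<circ> inv \<pi> permutes \<pi> ` X" if "\<rho> permutes X" for \<rho>
  proof (rule permutes_if_bij)
    show "bij (\<pi> \<circ> \<rho> \<circ> inv \<pi>)"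
      using assms that by (intro bij_comp bij_imp_bij_inv) (auto simp: permutes_bij)
    fix x assume "x \<notin> \<pi> ` X"
    then have "inv \<pi> x \<notin> X"
      using assms by (metis bij_inv_eq_iff imageI)
    then show "(\<pi> \<circ> \<rho> \<circ> inv \<pi>) x = x"
      using that assms by (simp add: permutes_not_in bij_is_surj surj_f_inv_f)
  qed
  have conj': "inv \<pi> \<circ> \<rho> \<circ> \<pi> permutes X" if "\<rho> permutes \<pi> ` X" for \<rho>
  proof (rule permutes_if_bij)
    show "bij (inv \<pi> \<circ> \<rho> \<circ> \<pi>)"
      using assms that by (intro bij_comp bij_imp_bij_inv) (auto simp: permutes_bij)
    fix x assume "x \<notin> X"
    then have "\<pi> x \<notin> \<pi> ` X"
      using assms by (simp add: bij_is_inj inj_image_mem_iff)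
    then show "(inv \<pi> \<circ> \<rho> \<circ> \<pi>) x = x"
      using that assms by (simp add: permutes_not_in bij_is_inj)
  qed
  have "(\<Sum>\<rho> | \<rho> permutes X. f (\<sigma> \<circ> \<pi> \<circ> \<rho>)) = (\<Sum>\<rho> | \<rho> permutes \<pi> ` X. f (\<sigma> \<circ> \<rho> \<circ> \<pi>))"
  proof (rule sum.reindex_bij_witness[where i = "\<lambda>\<rho>. inv \<pi> \<circ> \<rho> \<circ> \<pi>" and j = "\<lambda>\<rho>. \<pi> \<circ> \<rho> \<circ> inv \<pi>"])
    fix \<rho>
    have e: "inv \<pi> \<circ> (\<pi> \<circ> \<rho> \<circ> inv \<pi>) \<circ> \<pi> = (inv \<pi> \<circ> \<pi>) \<circ> \<rho> \<circ> (inv \<pi> \<circ> \<pi>)"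
      "\<pi> \<circ> (inv \<pi> \<circ> \<rho> \<circ> \<pi>) \<circ> inv \<pi> = (\<pi> \<circ> inv \<pi>) \<circ> \<rho> \<circ> (\<pi> \<circ> inv \<pi>)"
      "\<sigma> \<circ> (\<pi> \<circ> \<rho> \<circ> inv \<pi>) \<circ> \<pi> = \<sigma> \<circ> \<pi> \<circ> \<rho> \<circ> (inv \<pi> \<circ> \<pi>)"
      by (simp_all only: o_assoc)
    show "inv \<pi> \<circ> (\<pi> \<circ> \<rho> \<circ> inv \<pi>) \<circ> \<pi> = \<rho>" "\<pi> \<circ> (inv \<pi> \<circ> \<rho> \<circ> \<pi>) \<circ> inv \<pi> = \<rho>"
      "f (\<sigma> \<circ> (\<pi> \<circ> \<rho> \<circ> inv \<pi>) \<circ> \<pi>) = f (\<sigma> \<circ> \<pi> \<circ> \<rho>)"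
      unfolding e inv by simp_all
  qed (use conj conj' in auto)
  moreover have "card (\<pi> ` X) = card X"
    by (rule card_image) (rule inj_on_subset[OF bij_is_inj[OF assms] subset_UNIV])
  ultimately show "shift \<pi> (avg X f) \<sigma> = avg (\<pi> ` X) (shift \<pi> f) \<sigma>"
    by (simp add: avg_def shift_def)
qed

lemma shift_laplacian:
  assumes "bij \<pi>"
  shows "shift \<pi> (laplacian D f) = laplacian (\<pi> ` D) (shift \<pi> f)"
proof
  fix \<sigma> :: "'a \<Rightarrow> 'a"
  have inj: "inj \<pi>" using assms by (rule bij_is_inj)
  have "\<sigma> \<circ> transpose (\<pi> a) (\<pi> b) \<circ> \<pi> = \<sigma> \<circ> \<pi> \<circ> transpose a b" for a b
    using inj by (auto simp: fun_eq_iff transpose_def inj_eq)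
  then show "shift \<pi> (laplacian D f) \<sigma> = laplacian (\<pi> ` D) (shift \<pi> f) \<sigma>"
    using inj by (simp add: laplacian_def shift_def sum.reindex inj_on_subset)
qed

text \<open>The transpositions of \<open>b\<close> with the points of \<open>insert b X\<close>
  represent the cosets of the permutations of \<open>X\<close>; by invariance \<open>f\<close> takes
  one value on each coset. The term \<open>f \<sigma>\<close> is the coset of the identity.\<close>

lemma avg_insert:
  assumes "finite X" "b \<notin> X" "\<And>\<pi>. \<pi> permutes X \<Longrightarrow> shift \<pi> f = f"
  shows "avg (insert b X) f \<sigma> = (f \<sigma> + (\<Sum>a\<in>X. f (\<sigma> \<circ> transpose a b))) / (card X + 1)"
proof -
  have "f (\<sigma> \<circ> (transpose b a \<circ> \<pi>)) = f (\<sigma> \<circ> transpose b a)" if "\<pi> permutes X" for a \<pi>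
    using fun_cong[OF assms(3)[OF that], of "\<sigma> \<circ> transpose b a"] by (simp add: shift_def o_assoc)
  then have "(\<Sum>\<pi> | \<pi> permutes insert b X. f (\<sigma> \<circ> \<pi>))
      = fact (card X) * (\<Sum>a\<in>insert b X. f (\<sigma> \<circ> transpose b a))"
    using assms(1,2)
    by (simp add: sum_over_permutations_insert card_permutations[OF refl] sum_distrib_left distrib_left)
  then show ?thesis
    using assms(1,2) by (simp add: avg_def transpose_commute[of b])
qed

section \<open>Self-adjointness, positivity and splitting of the Laplacian\<close>

context
  fixes V :: "'a set"
  assumes finite_V: "finite V"
begin

abbreviation ip :: "(('a \<Rightarrow> 'a) \<Rightarrow> real) \<Rightarrow> (('a \<Rightarrow> 'a) \<Rightarrow> real) \<Rightarrow> real" where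
  "ip \<equiv> dot {\<sigma>. \<sigma> permutes V}"

lemma dot_shift_shift: "\<pi> permutes V \<Longrightarrow> ip (shift \<pi> f) (shift \<pi> g) = ip f g"
  using sum_permutations_compose_right[of \<pi> V "\<lambda>\<sigma>. f \<sigma> * g \<sigma>"]
  by (simp add: dot_def shift_def)

lemma dot_shift_left:
  assumes "\<pi> permutes V"
  shows "ip (shift \<pi> f) g = ip f (shift (inv \<pi>) g)"
proof -
  have "ip (shift \<pi> f) (shift \<pi> (shift (inv \<pi>) g)) = ip f (shift (inv \<pi>) g)"
    using assms by (rule dot_shift_shift)
  then show ?thesis
    using assms by (simp add: shift_shift permutes_inv_o) (simp add: shift_def)
qed

lemma dot_avg_left: "dot S (avg X f) g = (\<Sum>\<pi> | \<pi> permutes X. dot S (shift \<pi> f) g) / fact (card X)"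
  unfolding dot_def avg_alt
  by (subst sum.swap) (simp add: sum_divide_distrib sum_distrib_right sum_distrib_left)

lemma dot_avg_right: "dot S f (avg X g) = (\<Sum>\<pi> | \<pi> permutes X. dot S f (shift \<pi> g)) / fact (card X)"
  using dot_avg_left[of S X g f] by (simp add: dot_commute)

lemma avg_selfadjoint:
  assumes "X \<subseteq> V"
  shows "ip (avg X f) g = ip f (avg X g)"
proof -
  have "(\<Sum>\<pi> | \<pi> permutes X. ip (shift \<pi> f) g) = (\<Sum>\<pi> | \<pi> permutes X. ip f (shift (inv \<pi>) g))"
    using assms by (intro sum.cong dot_shift_left) (auto intro: permutes_subset)
  also have "\<dots> = (\<Sum>\<pi> | \<pi> permutes X. ip f (shift \<pi> g))"
    by (rule sum_permutations_inverse[symmetric])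
  finally show ?thesis
    by (simp add: dot_avg_left dot_avg_right)
qed

lemma dot_avg_self:
  assumes "X \<subseteq> V"
  shows "ip f (avg X f) = ip (avg X f) (avg X f)"
  using avg_selfadjoint[OF assms, of f "avg X f"] assms finite_V
  by (simp add: avg_avg_subset finite_subset)

lemma dot_laplacian_right:
  "dot S f (laplacian D g) = (\<Sum>a\<in>D. \<Sum>b\<in>D. dot S f g - dot S f (shift (transpose a b) g)) / 2"
proof -
  have "(\<Sum>a\<in>D. \<Sum>b\<in>D. dot S f g - dot S f (shift (transpose a b) g))
      = (\<Sum>a\<in>D. \<Sum>b\<in>D. \<Sum>\<sigma>\<in>S. f \<sigma> * (g \<sigma> - g (\<sigma> \<circ> transpose a b)))"
    by (simp add: dot_def shift_def sum_subtractf right_diff_distrib)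
  also have "\<dots> = (\<Sum>\<sigma>\<in>S. \<Sum>a\<in>D. \<Sum>b\<in>D. f \<sigma> * (g \<sigma> - g (\<sigma> \<circ> transpose a b)))"
    by (subst sum.swap[of _ _ D], subst sum.swap[of _ _ D]) (rule refl)
  also have "\<dots> = 2 * dot S f (laplacian D g)"
    by (simp add: dot_def laplacian_def flip: sum_distrib_left sum_divide_distrib)
  finally show ?thesis by simp
qed

lemma dot_shift_transpose:
  assumes "a \<in> V" "b \<in> V"
  shows "ip (shift (transpose a b) f) g = ip f (shift (transpose a b) g)"
  using assms by (subst dot_shift_left) (auto simp: permutes_swap_id)

lemma laplacian_selfadjoint:
  assumes "D \<subseteq> V"
  shows "ip (laplacian D f) g = ip f (laplacian D g)"
proof -
  have "ip g (shift (transpose a b) f) = ip f (shift (transpose a b) g)" if "a \<in> D" "b \<in> D" for a b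
    using assms that dot_shift_transpose[of a b f g] by (auto simp: dot_commute)
  then show ?thesis
    by (subst dot_commute) (simp add: dot_laplacian_right dot_commute[of _ g f])
qed

text \<open>Translations are isometries, so each summand
  \<open>\<langle>f, f\<rangle> - \<langle>f, g\<rangle>\<close> with \<open>g\<close> a translate
  of \<open>f\<close> is half the squared norm of \<open>f - g\<close>.\<close>

lemma laplacian_nonneg:
  assumes "D \<subseteq> V"
  shows "ip f (laplacian D f) \<ge> 0"
  unfolding dot_laplacian_right
proof (intro divide_nonneg_nonneg sum_nonneg)
  fix a b assume ab: "a \<in> D" "b \<in> D"
  define g where "g = shift (transpose a b) f"
  have "ip g g = ip f f"
    unfolding g_def using ab assms by (intro dot_shift_shift permutes_swap_id) auto
  moreover have "0 \<le> ip (\<lambda>\<sigma>. f \<sigma> + (- 1) * g \<sigma>) (\<lambda>\<sigma>. f \<sigma> + (- 1) * g \<sigma>)"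
    by (rule dot_self_nonneg)
  ultimately show "0 \<le> ip f f - ip f (shift (transpose a b) f)"
    unfolding dot_add_left dot_add_right g_def[symmetric] by (simp add: dot_commute[of _ g f])
qed simp

text \<open>Pairs inside \<open>Y\<close> contribute 0 by invariance, and pairs inside
  \<open>D - Y\<close> form the smaller Laplacian. For \<open>b\<close> outside \<open>Y\<close> the
  vanishing average says that the values at the transpositions of \<open>b\<close> with
  \<open>Y\<close> sum to \<open>- v \<sigma>\<close>, so the mixed pairs at \<open>b\<close> give
  \<open>card Y + 1\<close> times \<open>v \<sigma>\<close>.\<close>

lemma laplacian_split:
  fixes v :: "('a \<Rightarrow> 'a) \<Rightarrow> real"
  assumes D: "D \<subseteq> V" and Y: "Y \<subseteq> D"
    and inv: "\<And>\<pi>. \<pi> permutes Y \<Longrightarrow> shift \<pi> v = v"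
    and zero: "\<And>b \<sigma>. b \<in> D - Y \<Longrightarrow> \<sigma> permutes V \<Longrightarrow> avg (insert b Y) v \<sigma> = 0"
    and \<sigma>: "\<sigma> permutes V"
  shows "laplacian D v \<sigma> = real (card Y + 1) * real (card D - card Y) * v \<sigma> + laplacian (D - Y) v \<sigma>"
proof -
  define d where "d = (\<lambda>a b. v \<sigma> - v (\<sigma> \<circ> transpose a b))"

  have fin: "finite D" "finite Y"
    using D Y finite_V by (meson finite_subset)+
  have d_commute: "d a b = d b a" for a b
    by (simp add: d_def transpose_commute)
  have YY: "d a b = 0" if "a \<in> Y" "b \<in> Y" for a b
    using fun_cong[OF inv[of "transpose a b"], of \<sigma>] that
    by (simp add: d_def shift_def permutes_swap_id)
  have Yb: "(\<Sum>a\<in>Y. d a b) = real (card Y + 1) * v \<sigma>" if "b \<in> D - Y" for b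
    using zero[OF that \<sigma>] that fin(2)
    by (subst (asm) avg_insert) (auto simp: inv d_def sum_subtractf algebra_simps)
  have split: "sum g D = sum g Y + sum g (D - Y)" for g :: "'a \<Rightarrow> real"
    using fin Y by (metis add.commute sum.subset_diff)
  have cross: "(\<Sum>b\<in>D - Y. \<Sum>a\<in>Y. d a b) = real (card Y + 1) * real (card D - card Y) * v \<sigma>"
    using Yb fin Y by (simp add: card_Diff_subset card_mono of_nat_diff)
  have "(\<Sum>a\<in>D. \<Sum>b\<in>D. d a b) = (\<Sum>a\<in>Y. \<Sum>b\<in>D - Y. d a b) + (\<Sum>a\<in>D - Y. \<Sum>b\<in>Y. d a b)
      + (\<Sum>a\<in>D - Y. \<Sum>b\<in>D - Y. d a b)"
    by (simp add: split sum.distrib YY)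
  also have "(\<Sum>a\<in>Y. \<Sum>b\<in>D - Y. d a b) = (\<Sum>b\<in>D - Y. \<Sum>a\<in>Y. d a b)"
    by (rule sum.swap)
  also have "(\<Sum>a\<in>D - Y. \<Sum>b\<in>Y. d a b) = (\<Sum>b\<in>D - Y. \<Sum>a\<in>Y. d a b)"
    by (simp add: d_commute)
  finally show ?thesis
    using cross by (simp add: laplacian_def d_def)
qed

end

section \<open>Reduction of a spectral inequality to functions killed by larger averages\<close>

context
  fixes V :: "'a set"
  assumes finite_V: "finite V"
begin

text \<open>A permutation of \<open>Y\<close> also permutes the subsets of \<open>D\<close> of size
  \<open>m\<close>, so translates of \<open>f\<close> are killed by the same family of averages, and
  \<open>avg Y f\<close> is a mean of such translates.\<close>

lemma avg_vanishes:
  assumes D: "D \<subseteq> V" and Y: "Y \<subseteq> D"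
    and zero: "\<And>Z \<sigma>. Z \<subseteq> D \<Longrightarrow> card Z = m \<Longrightarrow> \<sigma> permutes V \<Longrightarrow> avg Z f \<sigma> = 0"
    and Z: "Z \<subseteq> D" "card Z = m" and \<sigma>: "\<sigma> permutes V"
  shows "avg Z (avg Y f) \<sigma> = 0"
proof -
  have "avg Z (shift \<pi> f) \<sigma> = 0" if "\<pi> permutes Y" for \<pi>
  proof -
    have \<pi>: "\<pi> permutes D" "\<pi> permutes V"
      using that Y D by (auto intro: permutes_subset)
    then have bij: "bij \<pi>" and inj: "inj \<pi>"
      by (auto intro: permutes_bij permutes_inj)
    define W where "W = inv \<pi> ` Z"
    have W: "\<pi> ` W = Z"
      using bij by (simp add: W_def bij_is_surj image_f_inv_f)
    then have "card W = m"
      using Z card_image[OF inj_on_subset[OF inj subset_UNIV], of W] by simp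
    moreover have "W \<subseteq> D"
      using Z permutes_image[OF permutes_inv[OF \<pi>(1)]] by (auto simp: W_def)
    moreover have "\<sigma> \<circ> \<pi> permutes V"
      using \<pi> \<sigma> by (simp add: permutes_compose)
    ultimately have "avg W f (\<sigma> \<circ> \<pi>) = 0"
      using zero by blast
    then show ?thesis
      using fun_cong[OF shift_avg_conj[OF bij, of W f], of \<sigma>] W by (simp add: shift_def)
  qed
  then show ?thesis
    by (simp add: avg_avg)
qed

text \<open>The claim is positivity of one self-adjoint operator, so its least eigenvalue decides.
  That operator commutes with permutations of \<open>D\<close>, hence each nonzero
  \<open>avg Y u\<close> of an eigenvector \<open>u\<close> has the same eigenvalue. The assumption
  \<open>step\<close> covers the one case not settled by the averages themselves.\<close>

lemma laplacian_lower_bound: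
  assumes D: "D \<subseteq> V" "D \<noteq> {}" and "c \<ge> 0"
    and step: "\<And>v Y. Y \<subseteq> D \<Longrightarrow> Y \<noteq> {} \<Longrightarrow> card Y < q \<Longrightarrow> (\<And>\<pi>. \<pi> permutes Y \<Longrightarrow> shift \<pi> v = v) \<Longrightarrow>
      (\<And>Z \<sigma>. Z \<subseteq> D \<Longrightarrow> card Z = card Y + 1 \<Longrightarrow> \<sigma> permutes V \<Longrightarrow> avg Z v \<sigma> = 0) \<Longrightarrow>
      ip V v (laplacian D v) \<ge> c * ip V v v"
  shows "ip V f (laplacian D f) \<ge> c * (ip V f f - (\<Sum>Z | Z \<subseteq> D \<and> card Z = q. ip V f (avg Z f)))"
proof -
  let ?\<Z> = "{Z. Z \<subseteq> D \<and> card Z = q}"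
  have finD: "finite D"
    using D finite_V by (blast intro: finite_subset)
  then have fin: "finite ?\<Z>" by simp
  \<comment> \<open>The inequality to prove is nonnegativity of the quadratic form of
    \<open>T\<close>.\<close>
  define T where "T = (\<lambda>f \<sigma>. laplacian D f \<sigma> + c * ((\<Sum>Z\<in>?\<Z>. avg Z f \<sigma>) - f \<sigma>))"
  have dot_T: "ip V f (T g) = ip V f (laplacian D g) + c * ((\<Sum>Z\<in>?\<Z>. ip V f (avg Z g)) - ip V f g)"
    for f g
  proof -
    have "ip V f (T g) = ip V f (laplacian D g) + c * ip V f (\<lambda>\<sigma>. (\<Sum>Z\<in>?\<Z>. avg Z g \<sigma>) + (- 1) * g \<sigma>)"
      by (simp only: T_def dot_add_right[symmetric]) simp
    also have "ip V f (\<lambda>\<sigma>. (\<Sum>Z\<in>?\<Z>. avg Z g \<sigma>) + (- 1) * g \<sigma>)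
        = (\<Sum>Z\<in>?\<Z>. ip V f (avg Z g)) - ip V f g"
      by (subst dot_add_right) (simp add: dot_def sum_distrib_left sum.swap[of _ ?\<Z>] sum_negf)
    finally show ?thesis .
  qed
  have subV: "Z \<subseteq> V" if "Z \<in> ?\<Z>" for Z
    using that D by auto
  have compose: "\<sigma> \<circ> \<pi> permutes V" if "\<sigma> permutes V" "\<pi> permutes X" "X \<subseteq> D" for \<sigma> \<pi> X
    using that D by (meson permutes_compose permutes_subset)
  have local_avg: "avg X f \<sigma> = avg X g \<sigma>"
    if "\<And>\<sigma>. \<sigma> permutes V \<Longrightarrow> f \<sigma> = g \<sigma>" "\<sigma> permutes V" "X \<subseteq> D" for X \<sigma> and f g :: "('a \<Rightarrow> 'a) \<Rightarrow> real"
    unfolding avg_def using that compose by (auto intro!: sum.cong)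
  have "finite {\<sigma>. \<sigma> permutes V}" "{\<sigma>. \<sigma> permutes V} \<noteq> {}"
    using finite_V by (auto simp: finite_permutations intro: permutes_id)
  moreover have "T (\<lambda>\<sigma>. f \<sigma> + a * g \<sigma>) = (\<lambda>\<sigma>. T f \<sigma> + a * T g \<sigma>)" for f g a
    unfolding T_def laplacian_linear avg_linear
    by (simp add: sum.distrib sum_distrib_left[symmetric] algebra_simps)
  moreover have "T f \<sigma> = T g \<sigma>"
    if "\<And>\<sigma>. \<sigma> \<in> {\<sigma>. \<sigma> permutes V} \<Longrightarrow> f \<sigma> = g \<sigma>" "\<sigma> \<in> {\<sigma>. \<sigma> permutes V}"
    for f g \<sigma>
  proof -
    have "f (\<sigma> \<circ> transpose a b) = g (\<sigma> \<circ> transpose a b)" if "a \<in> D" "b \<in> D" for a b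
      using that \<open>\<sigma> \<in> _\<close> compose[of \<sigma> "transpose a b" D] permutes_swap_id[of a D b]
      by (intro \<open>\<And>\<sigma>. _ \<Longrightarrow> f \<sigma> = g \<sigma>\<close>) simp
    then have "laplacian D f \<sigma> = laplacian D g \<sigma>"
      using that by (simp add: laplacian_def)
    moreover have "(\<Sum>Z\<in>?\<Z>. avg Z f \<sigma>) = (\<Sum>Z\<in>?\<Z>. avg Z g \<sigma>)"
      using that by (intro sum.cong local_avg) auto
    ultimately show ?thesis
      using that by (simp add: T_def)
  qed
  moreover have "ip V (T f) g = ip V f (T g)" for f g
  proof -
    have "(\<Sum>Z\<in>?\<Z>. ip V g (avg Z f)) = (\<Sum>Z\<in>?\<Z>. ip V f (avg Z g))"
      using avg_selfadjoint[OF finite_V subV, of _ f g] by (intro sum.cong) (simp_all add: dot_commute)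
    moreover have "ip V g (laplacian D f) = ip V f (laplacian D g)"
      using laplacian_selfadjoint[OF finite_V D(1), of f g] by (simp add: dot_commute)
    ultimately show ?thesis
      by (simp only: dot_commute[of _ "T f"] dot_T dot_commute[of _ g f])
  qed
  ultimately obtain u \<mu> where u1: "ip V u u = 1" and eigen: "\<And>\<sigma>. \<sigma> permutes V \<Longrightarrow> T u \<sigma> = \<mu> * u \<sigma>"
    and min: "\<And>h. ip V h (T h) \<ge> \<mu> * ip V h h"
    by (rule rayleigh_minimizer[where T = T and S = "{\<sigma>. \<sigma> permutes V}"]) blast+
  \<comment> \<open>Translation by a permutation of \<open>Y\<close> merely permutes the sets in
    \<open>?\<Z>\<close> and fixes \<open>laplacian D\<close>, so \<open>T\<close> commutes with
    it.\<close>
  have T_avg: "T (avg Y u) \<sigma> = \<mu> * avg Y u \<sigma>" if Y: "Y \<subseteq> D" and \<sigma>: "\<sigma> permutes V" for Y \<sigma>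
  proof -
    have T_shift: "T (shift \<pi> u) \<sigma> = shift \<pi> (T u) \<sigma>" if "\<pi> permutes Y" for \<pi> \<sigma>
    proof -
      have \<pi>: "\<pi> permutes D"
        using that Y by (rule permutes_subset)
      then have bij: "bij \<pi>" by (rule permutes_bij)
      have "shift \<pi> (T u) \<sigma> = shift \<pi> (laplacian D u) \<sigma>
          + c * ((\<Sum>Z\<in>?\<Z>. shift \<pi> (avg Z u) \<sigma>) - shift \<pi> u \<sigma>)"
        by (simp add: T_def shift_def)
      also have "shift \<pi> (laplacian D u) = laplacian D (shift \<pi> u)"
        by (simp add: shift_laplacian[OF bij] permutes_image[OF \<pi>])
      also have "(\<Sum>Z\<in>?\<Z>. shift \<pi> (avg Z u) \<sigma>) = (\<Sum>Z\<in>?\<Z>. avg (\<pi> ` Z) (shift \<pi> u) \<sigma>)"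
        by (simp add: shift_avg_conj[OF bij])
      also have "\<dots> = (\<Sum>Z\<in>?\<Z>. avg Z (shift \<pi> u) \<sigma>)"
      proof (rule sum.reindex_bij_witness[where i = "image (inv \<pi>)" and j = "image \<pi>"])
        fix Z assume Z: "Z \<in> ?\<Z>"
        show "inv \<pi> ` \<pi> ` Z = Z" "\<pi> ` inv \<pi> ` Z = Z"
          using bij by (simp_all add: bij_is_inj bij_is_surj image_f_inv_f image_inv_f_f)
        have "\<pi> ` Z \<subseteq> D" "inv \<pi> ` Z \<subseteq> D"
          using Z permutes_in_image[OF \<pi>] permutes_in_image[OF permutes_inv[OF \<pi>]] by auto
        moreover have "card (\<pi> ` Z) = card Z" "card (inv \<pi> ` Z) = card Z"
          by (rule card_image[OF inj_on_subset[OF _ subset_UNIV]],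
              use bij in \<open>simp add: bij_is_inj bij_imp_bij_inv\<close>)+
        ultimately show "\<pi> ` Z \<in> ?\<Z>" "inv \<pi> ` Z \<in> ?\<Z>"
          using Z by auto
      qed simp
      finally show ?thesis by (simp add: T_def)
    qed
    have lap: "laplacian D (avg Y u) \<sigma> = (\<Sum>\<pi> | \<pi> permutes Y. laplacian D (shift \<pi> u) \<sigma>) / fact (card Y)"
    proof -
      have "laplacian D (avg Y u) \<sigma> = (\<Sum>a\<in>D. \<Sum>b\<in>D. \<Sum>\<pi> | \<pi> permutes Y.
          shift \<pi> u \<sigma> - shift \<pi> u (\<sigma> \<circ> transpose a b)) / fact (card Y) / 2"
        by (simp add: laplacian_def avg_alt sum_subtractf diff_divide_distrib
            flip: sum_divide_distrib)
      also have "(\<Sum>a\<in>D. \<Sum>b\<in>D. \<Sum>\<pi> | \<pi> permutes Y. shift \<pi> u \<sigma> - shift \<pi> u (\<sigma> \<circ> transpose a b))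
          = (\<Sum>\<pi> | \<pi> permutes Y. \<Sum>a\<in>D. \<Sum>b\<in>D. shift \<pi> u \<sigma> - shift \<pi> u (\<sigma> \<circ> transpose a b))"
        by (simp only: sum.swap[of _ "{\<pi>. \<pi> permutes Y}" D])
      finally show ?thesis
        by (simp add: laplacian_def flip: sum_divide_distrib)
    qed
    have "T (avg Y u) \<sigma> = (\<Sum>\<pi> | \<pi> permutes Y. T (shift \<pi> u) \<sigma>) / fact (card Y)"
    proof -
      have "(\<Sum>Z\<in>?\<Z>. avg Z (avg Y u) \<sigma>)
          = (\<Sum>\<pi> | \<pi> permutes Y. \<Sum>Z\<in>?\<Z>. avg Z (shift \<pi> u) \<sigma>) / fact (card Y)"
        by (simp add: avg_avg sum.swap[of _ "{\<pi>. \<pi> permutes Y}"] flip: sum_divide_distrib)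
      then show ?thesis
        unfolding T_def lap
        by (simp add: avg_alt[of Y] sum.distrib sum_subtractf add_divide_distrib diff_divide_distrib
            flip: sum_distrib_left)
          (simp add: diff_divide_distrib right_diff_distrib)
    qed
    also have "\<dots> = (\<Sum>\<pi> | \<pi> permutes Y. \<mu> * shift \<pi> u \<sigma>) / fact (card Y)"
      using T_shift eigen compose[OF \<sigma> _ Y] by (simp add: shift_def)
    also have "\<dots> = \<mu> * avg Y u \<sigma>"
      by (simp add: avg_alt flip: sum_distrib_left)
    finally show ?thesis .
  qed
  have dot_T_avg: "ip V (avg Y u) (T (avg Y u)) = \<mu> * ip V (avg Y u) (avg Y u)" if "Y \<subseteq> D" for Y
  proof -
    have "ip V (avg Y u) (T (avg Y u)) = ip V (avg Y u) (\<lambda>\<sigma>. 0 + \<mu> * avg Y u \<sigma>)"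
      using T_avg[OF that] by (intro dot_cong) auto
    then show ?thesis
      by (subst (asm) dot_add_right) (simp add: dot_def)
  qed
  let ?null = "\<lambda>Y. \<forall>\<sigma>. \<sigma> permutes V \<longrightarrow> avg Y u \<sigma> = 0"
  have pos: "ip V (avg Y u) (avg Y u) > 0" if "\<not> ?null Y" for Y
    using that finite_V dot_self_nonneg[of "{\<sigma>. \<sigma> permutes V}" "avg Y u"]
      dot_self_eq_0_iff[of "{\<sigma>. \<sigma> permutes V}" "avg Y u"]
    by (auto simp: finite_permutations less_le)
  have "\<mu> \<ge> 0"
  proof (cases "\<exists>Z\<in>?\<Z>. \<not> ?null Z")
    case True
    then obtain Z where Z: "Z \<in> ?\<Z>" and "\<not> ?null Z" by blast
    define v where "v = avg Z u"
    have "avg Z v = v"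
      using Z finD unfolding v_def by (intro avg_avg_subset) (auto intro: finite_subset)
    then have "ip V v v = ip V v (avg Z v)" by simp
    \<comment> \<open>Averages are projections, so all other terms are nonnegative and the single
      set \<open>Z\<close> already pays for the subtracted
      \<open>\<langle>v, v\<rangle>\<close>.\<close>
    also have "\<dots> \<le> (\<Sum>Z\<in>?\<Z>. ip V v (avg Z v))"
    proof (rule member_le_sum[OF Z _ fin])
      fix W assume "W \<in> ?\<Z> - {Z}"
      then show "0 \<le> ip V v (avg W v)"
        using dot_avg_self[OF finite_V, of W v] D by (auto simp: dot_self_nonneg)
    qed
    finally have "c * ((\<Sum>Z\<in>?\<Z>. ip V v (avg Z v)) - ip V v v) \<ge> 0"
      using \<open>c \<ge> 0\<close> by simp
    then have "ip V v (T v) \<ge> 0"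
      using laplacian_nonneg[OF finite_V D(1), of v] by (simp add: dot_T)
    then show ?thesis
      using dot_T_avg[of Z] pos[OF \<open>\<not> ?null Z\<close>] Z unfolding v_def[symmetric]
      by (simp add: zero_le_mult_iff)
  next
    case False
    \<comment> \<open>Sizes of nonempty sets whose average does not kill \<open>u\<close>. Averaging
      over a singleton is the identity, so 1 lies in \<open>?J\<close>; for \<open>q \<le> 1\<close>
      the current case would force \<open>u\<close> to vanish.\<close>
    let ?J = "{j. j < q \<and> (\<exists>Y. Y \<subseteq> D \<and> Y \<noteq> {} \<and> card Y = j \<and> \<not> ?null Y)}"
    obtain x where x: "x \<in> D" using D by blast
    have "avg {x} u = u"
      by (rule avg_invariant) (auto simp: permutes_sing shift_def)
    then have null1: "\<not> ?null {x}"
      using u1 dot_self_eq_0_iff[of "{\<sigma>. \<sigma> permutes V}" u] finite_V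
      by (auto simp: finite_permutations)
    have "card {x} < q"
    proof (rule ccontr)
      assume "\<not> card {x} < q"
      then consider "q = 0" | "q = 1" by fastforce
      then show False
      proof cases
        case 1
        then have "{} \<in> ?\<Z>" by simp
        moreover have "avg {} u = u"
          by (rule avg_invariant) (auto simp: shift_def)
        ultimately show False
          using False null1 \<open>avg {x} u = u\<close> by metis
      next
        case 2
        then show False
          using False null1 x by auto
      qed
    qed
    with x null1 have J: "card {x} \<in> ?J" by blast
    have finJ: "finite ?J" by simp
    define j where "j = Max ?J"
    have "j \<in> ?J" unfolding j_def using J finJ by (intro Max_in) auto
    then obtain Y where Y: "Y \<subseteq> D" "Y \<noteq> {}" "card Y = j" "\<not> ?null Y" "j < q" by blast
    \<comment> \<open>By maximality of \<open>j\<close>, or, when \<open>j + 1 = q\<close>, by the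
      assumption of the current case.\<close>
    have zero: "?null Z" if "Z \<subseteq> D" "card Z = j + 1" for Z
    proof (cases "j + 1 = q")
      case True
      then show ?thesis using that False by auto
    next
      case neq: False
      show ?thesis
      proof (rule ccontr)
        assume "\<not> ?null Z"
        moreover have "Z \<noteq> {}" using that by auto
        ultimately have "j + 1 \<in> ?J"
          using that neq Y by auto
        from Max_ge[OF finJ this] show False
          unfolding j_def[symmetric] by simp
      qed
    qed
    define v where "v = avg Y u"
    have "c * ip V v v \<le> ip V v (laplacian D v)"
    proof (rule step[OF Y(1,2)])
      show "card Y < q" using Y by simp
      show "shift \<pi> v = v" if "\<pi> permutes Y" for \<pi>
        unfolding v_def using that by (rule shift_avg)
      show "avg Z v \<sigma> = 0" if "Z \<subseteq> D" "card Z = card Y + 1" "\<sigma> permutes V" for Z \<sigma>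
        unfolding v_def using zero Y that by (intro avg_vanishes[OF D(1) Y(1)]) auto
    qed
    \<comment> \<open>The averages in \<open>T\<close> thus drop out at \<open>v\<close>, and
      \<open>step\<close> alone gives the sign.\<close>
    moreover have "ip V v (avg Z v) = 0" if "Z \<in> ?\<Z>" for Z
    proof -
      have "avg Z v \<sigma> = 0" if "\<sigma> permutes V" for \<sigma>
        unfolding v_def using False that \<open>Z \<in> ?\<Z>\<close>
        by (intro avg_vanishes[OF D(1) Y(1), where m = q]) auto
      then show ?thesis by (simp add: dot_def)
    qed
    ultimately have "ip V v (T v) \<ge> 0"
      by (simp add: dot_T)
    then show ?thesis
      using dot_T_avg[of Y] pos[OF Y(4)] Y unfolding v_def[symmetric]
      by (simp add: zero_le_mult_iff)
  qed
  then have "0 \<le> ip V f (T f)"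
    using min[of f] dot_self_nonneg[of "{\<sigma>. \<sigma> permutes V}" f]
    by (meson mult_nonneg_nonneg order_trans)
  then show ?thesis
    by (simp add: dot_T algebra_simps)
qed

end

section \<open>The spectral gap inequality\<close>

context
  fixes V :: "'a set"
  assumes finite_V: "finite V"
begin

lemma dot_laplacian_split:
  assumes D: "D \<subseteq> V" and Y: "Y \<subseteq> D"
    and inv: "\<And>\<pi>. \<pi> permutes Y \<Longrightarrow> shift \<pi> v = v"
    and zero: "\<And>Z \<sigma>. Z \<subseteq> D \<Longrightarrow> card Z = card Y + 1 \<Longrightarrow> \<sigma> permutes V \<Longrightarrow> avg Z v \<sigma> = 0"
  shows "ip V v (laplacian D v)
    = real (card Y + 1) * real (card D - card Y) * ip V v v + ip V v (laplacian (D - Y) v)"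
proof -
  have fin: "finite Y"
    using D Y finite_V by (meson finite_subset)
  have "ip V v (laplacian D v)
      = ip V v (\<lambda>\<sigma>. laplacian (D - Y) v \<sigma> + real (card Y + 1) * real (card D - card Y) * v \<sigma>)"
  proof (rule dot_cong[OF refl])
    fix \<sigma> assume "\<sigma> \<in> {\<sigma>. \<sigma> permutes V}"
    then show "laplacian D v \<sigma>
        = laplacian (D - Y) v \<sigma> + real (card Y + 1) * real (card D - card Y) * v \<sigma>"
      using laplacian_split[OF finite_V D Y inv, of \<sigma>] zero Y fin by simp
  qed
  then show ?thesis
    by (simp only: dot_add_right)
qed

text \<open>Strong induction on \<open>card D\<close> through \<open>laplacian_lower_bound\<close>
  with \<open>q = j + 1\<close>, where all subtracted averages vanish. After splitting off
  \<open>Y\<close>, the same function satisfies the hypothesis on the smaller set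
  \<open>D - Y\<close> with \<open>card Y\<close> in place of \<open>j\<close>.\<close>

lemma laplacian_ge_of_avg_vanishing:
  assumes "D \<subseteq> V"
    and "\<And>Z \<sigma>. Z \<subseteq> D \<Longrightarrow> card Z = j + 1 \<Longrightarrow> \<sigma> permutes V \<Longrightarrow> avg Z f \<sigma> = 0"
  shows "ip V f (laplacian D f) \<ge> card D * (real (card D) - j) / 2 * ip V f f"
  using assms
proof (induction "card D" arbitrary: D j f rule: less_induct)
  case less
  have finD: "finite D"
    using less.prems(1) finite_V by (rule finite_subset)
  show ?case
  proof (cases "card D \<le> j")
    case True
    then have "card D * (real (card D) - j) / 2 \<le> 0"
      by (simp add: mult_nonneg_nonpos)
    then have "card D * (real (card D) - j) / 2 * ip V f f \<le> 0"
      by (rule mult_nonpos_nonneg) (rule dot_self_nonneg)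
    also have "0 \<le> ip V f (laplacian D f)"
      by (rule laplacian_nonneg[OF finite_V less.prems(1)])
    finally show ?thesis .
  next
    case False
    let ?c = "card D * (real (card D) - j) / 2"
    have "ip V f (laplacian D f)
        \<ge> ?c * (ip V f f - (\<Sum>Z | Z \<subseteq> D \<and> card Z = j + 1. ip V f (avg Z f)))"
    proof (rule laplacian_lower_bound[OF finite_V less.prems(1)])
      show "D \<noteq> {}" "0 \<le> ?c" using False by auto
      fix v Y
      assume Y: "Y \<subseteq> D" "Y \<noteq> {}" "card Y < j + 1"
        and inv: "\<And>\<pi>. \<pi> permutes Y \<Longrightarrow> shift \<pi> v = v"
        and zero: "\<And>Z \<sigma>. Z \<subseteq> D \<Longrightarrow> card Z = card Y + 1 \<Longrightarrow> \<sigma> permutes V \<Longrightarrow> avg Z v \<sigma> = 0"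
      define d i where "d = card D" and "i = card Y"
      have "i \<le> d"
        using Y finD by (simp add: d_def i_def card_mono)
      have card: "card (D - Y) = d - i"
        using Y finD by (simp add: d_def i_def card_Diff_subset finite_subset)
      have "card (D - Y) < card D"
        using Y finD by (intro psubset_card_mono) auto
      then have "ip V v (laplacian (D - Y) v)
          \<ge> card (D - Y) * (real (card (D - Y)) - card Y) / 2 * ip V v v"
        using less.prems(1) zero by (intro less.hyps) auto
      then have "ip V v (laplacian D v)
          \<ge> (real (i + 1) * real (d - i) + real (d - i) * (real (d - i) - i) / 2) * ip V v v"
        using dot_laplacian_split[OF less.prems(1) Y(1), of v] inv zero
        by (simp add: card distrib_right flip: d_def i_def)
      \<comment> \<open>The right side equals \<open>(d - i) (d + 2) / 2\<close>, which suffices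
        because \<open>i \<le> j\<close>.\<close>
      moreover have "?c \<le> real (i + 1) * real (d - i) + real (d - i) * (real (d - i) - i) / 2"
      proof -
        have "real (i + 1) * real (d - i) + real (d - i) * (real (d - i) - i) / 2
            = (real d - i) * (d + 2) / 2"
          using \<open>i \<le> d\<close> by (simp add: of_nat_diff field_simps)
        moreover have "real d * (real d - j) \<le> (real d - i) * (d + 2)"
        proof -
          have "real d * (real d - j) \<le> real d * (real d - i)"
            using Y by (intro mult_left_mono) (auto simp: i_def)
          also have "\<dots> \<le> (real d - i) * (d + 2)"
            using \<open>i \<le> d\<close> by (simp add: algebra_simps)
          finally show ?thesis .
        qed
        ultimately show ?thesis
          by (simp add: d_def)
      qed
      ultimately show "?c * ip V v v \<le> ip V v (laplacian D v)"
        using mult_right_mono[OF _ dot_self_nonneg] by (meson order_trans)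
    qed
    moreover have "ip V f (avg Z f) = 0" if "Z \<subseteq> D" "card Z = j + 1" for Z
      using less.prems(2)[OF that] by (simp add: dot_def)
    ultimately show ?thesis by simp
  qed
qed

text \<open>Here \<open>j = card Y\<close> is at most \<open>n - t\<close>. The concave function
  \<open>(j+1)(n-j)\<close> equals \<open>t(n-t+1)\<close> at both \<open>j = t-1\<close> and
  \<open>j = n-t\<close>, so the split alone suffices in between; smaller \<open>j\<close> need the
  iterated bound \<open>n(n-j)/2\<close>.\<close>

lemma spectral_bound:
  assumes n: "card V = n" and t: "t \<ge> 1" "3 * t \<le> n"
  shows "ip V f (laplacian V f)
    \<ge> real (t * (n - t + 1)) * (ip V f f - (\<Sum>Z | Z \<subseteq> V \<and> card Z = n - t + 1. ip V f (avg Z f)))"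
proof (rule laplacian_lower_bound[OF finite_V subset_refl])
  show "V \<noteq> {}" using n t by auto
  show "0 \<le> real (t * (n - t + 1))" by simp
  fix v Y
  assume Y: "Y \<subseteq> V" "Y \<noteq> {}" "card Y < n - t + 1"
    and inv: "\<And>\<pi>. \<pi> permutes Y \<Longrightarrow> shift \<pi> v = v"
    and zero: "\<And>Z \<sigma>. Z \<subseteq> V \<Longrightarrow> card Z = card Y + 1 \<Longrightarrow> \<sigma> permutes V \<Longrightarrow> avg Z v \<sigma> = 0"
  define j where "j = card Y"
  have j: "j + t \<le> n" using Y t by (simp add: j_def)
  have tn: "real (t * (n - t + 1)) = real t * (real n - real t + 1)"
    using t by (simp add: of_nat_diff distrib_left)
  have "\<exists>c \<ge> real (t * (n - t + 1)). c * ip V v v \<le> ip V v (laplacian V v)"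
  proof (cases "t \<le> j + 1")
    case True
    have "real (j + 1) * real (n - j) - real (t * (n - t + 1)) = (real j + 1 - t) * (real n - j - t)"
      unfolding tn using j by (simp add: of_nat_diff algebra_simps)
    also have "\<dots> \<ge> 0"
      using True j by (intro mult_nonneg_nonneg) auto
    finally have "real (t * (n - t + 1)) \<le> real (j + 1) * real (n - j)" by simp
    moreover have "real (j + 1) * real (n - j) * ip V v v \<le> ip V v (laplacian V v)"
      using dot_laplacian_split[OF subset_refl Y(1), of v] inv zero
        laplacian_nonneg[OF finite_V, of "V - Y" v] by (simp add: n j_def)
    ultimately show ?thesis by blast
  next
    case False
    \<comment> \<open>Factor by factor: \<open>3 * t \<le> n\<close> gives
      \<open>t \<le> n / 2\<close>, and \<open>j < t - 1\<close> gives
      \<open>n - t + 1 \<le> n - j\<close>.\<close>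
    have "real t * (real n - real t + 1) \<le> (n / 2) * (real n - j)"
      using False t by (intro mult_mono) auto
    then have "real (t * (n - t + 1)) \<le> n * (real n - j) / 2"
      unfolding tn by simp
    moreover have "n * (real n - j) / 2 * ip V v v \<le> ip V v (laplacian V v)"
      using laplacian_ge_of_avg_vanishing[OF subset_refl, of j v] zero
      by (simp add: n j_def)
    ultimately show ?thesis by blast
  qed
  then show "real (t * (n - t + 1)) * ip V v v \<le> ip V v (laplacian V v)"
    using mult_right_mono[OF _ dot_self_nonneg] by (meson order_trans)
qed

section \<open>Indicator functions: agreements and boundary edges\<close>

text \<open>Double counting: if \<sigma> and \<rho> in \<open>A\<close> differ by a permutation of
  \<open>Z\<close>, then they agree on \<open>V - Z\<close>. So for a fixed pair the complements of
  the relevant \<open>Z\<close> are subsets of size \<open>card V - k\<close> of the agreement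
  set.\<close>

lemma sum_dot_avg_indicator_le:
  assumes A: "A \<subseteq> {\<sigma>. \<sigma> permutes V}" and k: "k \<le> card V"
  defines "f \<equiv> \<lambda>\<sigma>. of_bool (\<sigma> \<in> A)"
  shows "(\<Sum>Z | Z \<subseteq> V \<and> card Z = k. ip V f (avg Z f))
    \<le> (\<Sum>\<sigma>\<in>A. \<Sum>\<rho>\<in>A. real (card {x \<in> V. \<sigma> x = \<rho> x} choose (card V - k))) / fact k"
proof -
  let ?\<Z> = "{Z. Z \<subseteq> V \<and> card Z = k}"
  let ?P = "\<lambda>Z \<sigma> \<rho>. \<forall>x\<in>V - Z. \<sigma> x = \<rho> x"
  have finA: "finite A"
    using A finite_permutations[OF finite_V] by (rule finite_subset)
  have finP: "finite {\<sigma>. \<sigma> permutes V}"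
    using finite_V by (rule finite_permutations)
  have finZ: "finite ?\<Z>"
    using finite_V by simp
  have "ip V f (avg Z f) \<le> (\<Sum>\<sigma>\<in>A. \<Sum>\<rho>\<in>A. of_bool (?P Z \<sigma> \<rho>)) / fact k" if Z: "Z \<in> ?\<Z>" for Z
  proof -
    have finpZ: "finite {\<pi>. \<pi> permutes Z}"
      using Z finite_V by (auto intro: finite_permutations finite_subset)
    have "avg Z f \<sigma> \<le> (\<Sum>\<rho>\<in>A. of_bool (?P Z \<sigma> \<rho>)) / fact k" if "\<sigma> \<in> A" for \<sigma>
    proof -
      have "\<sigma> permutes V" using that A by auto
      then have "inj \<sigma>" by (rule permutes_inj)
      have "card {\<pi>. \<pi> permutes Z \<and> \<sigma> \<circ> \<pi> \<in> A} \<le> card {\<rho> \<in> A. ?P Z \<sigma> \<rho>}"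
      proof (rule card_inj_on_le[where f = "(\<circ>) \<sigma>"])
        show "inj_on ((\<circ>) \<sigma>) {\<pi>. \<pi> permutes Z \<and> \<sigma> \<circ> \<pi> \<in> A}"
          by (rule inj_on_subset[OF fun.inj_map[OF \<open>inj \<sigma>\<close>] subset_UNIV])
        show "(\<circ>) \<sigma> ` {\<pi>. \<pi> permutes Z \<and> \<sigma> \<circ> \<pi> \<in> A} \<subseteq> {\<rho> \<in> A. ?P Z \<sigma> \<rho>}"
          by (auto dest: permutes_not_in)
      qed (use finA in simp)
      then have "(\<Sum>\<pi> | \<pi> permutes Z. f (\<sigma> \<circ> \<pi>)) \<le> (\<Sum>\<rho>\<in>A. of_bool (?P Z \<sigma> \<rho>))"
        using finpZ finA by (simp add: f_def Int_def)
      then show ?thesis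
        using Z by (simp add: avg_def divide_right_mono)
    qed
    then have "(\<Sum>\<sigma>\<in>A. avg Z f \<sigma>) \<le> (\<Sum>\<sigma>\<in>A. (\<Sum>\<rho>\<in>A. of_bool (?P Z \<sigma> \<rho>)) / fact k)"
      by (rule sum_mono)
    moreover have "ip V f (avg Z f) = (\<Sum>\<sigma>\<in>A. avg Z f \<sigma>)"
      unfolding dot_def f_def using A finP by (intro sum.mono_neutral_cong_right) auto
    ultimately show ?thesis
      by (simp add: sum_divide_distrib)
  qed
  then have "(\<Sum>Z\<in>?\<Z>. ip V f (avg Z f))
      \<le> (\<Sum>Z\<in>?\<Z>. (\<Sum>\<sigma>\<in>A. \<Sum>\<rho>\<in>A. of_bool (?P Z \<sigma> \<rho>)) / fact k)"
    by (rule sum_mono)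
  also have "\<dots> = (\<Sum>\<sigma>\<in>A. \<Sum>\<rho>\<in>A. \<Sum>Z\<in>?\<Z>. of_bool (?P Z \<sigma> \<rho>)) / fact k"
    by (simp only: sum.swap[of _ A ?\<Z>] flip: sum_divide_distrib)
  also have "\<dots> \<le> (\<Sum>\<sigma>\<in>A. \<Sum>\<rho>\<in>A. real (card {x \<in> V. \<sigma> x = \<rho> x} choose (card V - k))) / fact k"
  proof (intro divide_right_mono sum_mono)
    fix \<sigma> \<rho>
    let ?E = "{x \<in> V. \<sigma> x = \<rho> x}"
    have "card {Z \<in> ?\<Z>. ?P Z \<sigma> \<rho>} \<le> card {W. W \<subseteq> ?E \<and> card W = card V - k}"
    proof (rule card_inj_on_le[where f = "\<lambda>Z. V - Z"])
      show "inj_on (\<lambda>Z. V - Z) {Z \<in> ?\<Z>. ?P Z \<sigma> \<rho>}"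
        by (auto simp: inj_on_def)
      show "(\<lambda>Z. V - Z) ` {Z \<in> ?\<Z>. ?P Z \<sigma> \<rho>} \<subseteq> {W. W \<subseteq> ?E \<and> card W = card V - k}"
        using finite_V by (auto simp: card_Diff_subset finite_subset)
    qed (use finite_V in simp)
    also have "\<dots> = card ?E choose (card V - k)"
      using finite_V by (simp add: n_subsets)
    finally show "(\<Sum>Z\<in>?\<Z>. of_bool (?P Z \<sigma> \<rho>)) \<le> real (card ?E choose (card V - k))"
      using finZ by (simp add: Int_def)
  qed simp
  finally show ?thesis .
qed

end

text \<open>Twice the form counts the triples in \<open>B\<close>, that is, steps leaving
  \<open>A\<close> with ordered pairs \<open>(a, b)\<close>. Each boundary edge arises from at most
  two triples: its endpoint in \<open>A\<close> is determined, and \<open>a < b\<close> tells the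
  two orders apart.\<close>

lemma dot_laplacian_indicator_le_boundary:
  assumes A: "A \<subseteq> Sym n"
  defines "f \<equiv> \<lambda>\<sigma>. of_bool (\<sigma> \<in> A)"
  shows "dot {\<sigma>. \<sigma> permutes {1..n}} f (laplacian {1..n} f) \<le> card (edge_boundary n A)"
proof -
  let ?V = "{1..n}"
  define B where "B = {(\<sigma>, a, b). \<sigma> \<in> A \<and> a \<in> ?V \<and> b \<in> ?V \<and> \<sigma> \<circ> transpose a b \<notin> A}"
  have perm: "\<sigma> permutes ?V" if "\<sigma> \<in> A" for \<sigma>
    using that A by (auto simp: Sym_def)
  have finP: "finite {\<sigma>. \<sigma> permutes ?V}"
    by (simp add: finite_permutations)
  then have finA: "finite A"
    by (rule finite_subset[rotated]) (auto dest: perm)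
  have "edge_boundary n A \<subseteq> Pow (Sym n)"
    using A by (auto simp: edge_boundary_def)
  then have finE: "finite (edge_boundary n A)"
    by (rule finite_subset) (use finP in \<open>simp add: Sym_def\<close>)
  have B_neq: "a \<noteq> b" if "(\<sigma>, a, b) \<in> B" for \<sigma> a b
    using that by (auto simp: B_def)
  have "card B \<le> card (edge_boundary n A \<times> (UNIV :: bool set))"
  proof (rule card_inj_on_le[where f = "\<lambda>(\<sigma>, a, b). ({\<sigma>, \<sigma> \<circ> transpose a b}, a < b)"])
    show "inj_on (\<lambda>(\<sigma>, a, b). ({\<sigma>, \<sigma> \<circ> transpose a b}, a < b)) B"
    proof (rule inj_onI)
      fix p p' assume p: "p \<in> B" "p' \<in> B"
        and eq: "(\<lambda>(\<sigma>, a, b). ({\<sigma>, \<sigma> \<circ> transpose a b}, a < b)) p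
          = (\<lambda>(\<sigma>, a, b). ({\<sigma>, \<sigma> \<circ> transpose a b}, a < b)) p'"
      obtain \<sigma> a b \<sigma>' a' b' where pp: "p = (\<sigma>, a, b)" "p' = (\<sigma>', a', b')"
        by (metis prod_cases3)
      have B: "(\<sigma>, a, b) \<in> B" "(\<sigma>', a', b') \<in> B"
        and "{\<sigma>, \<sigma> \<circ> transpose a b} = {\<sigma>', \<sigma>' \<circ> transpose a' b'}"
        and less: "(a < b) = (a' < b')"
        using p eq by (simp_all add: pp)
      then have \<sigma>: "\<sigma> = \<sigma>'" and eq': "\<sigma> \<circ> transpose a b = \<sigma> \<circ> transpose a' b'"
        by (auto simp: B_def doubleton_eq_iff)
      have "inj \<sigma>"
        using permutes_inj[OF perm, of \<sigma>] B by (simp add: B_def)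
      then have tr: "transpose a b = transpose a' b'"
        using eq' by (rule injD[OF fun.inj_map])
      have "transpose a' b' a = b" "transpose a' b' b = a"
        by (simp_all flip: tr)
      then have "a = a' \<and> b = b' \<or> a = b' \<and> b = a'"
        using B_neq[OF B(1)] by (auto simp: transpose_def split: if_splits)
      then show "p = p'"
        using \<sigma> less B_neq[OF B(1)] by (auto simp: pp)
    qed
    show "(\<lambda>(\<sigma>, a, b). ({\<sigma>, \<sigma> \<circ> transpose a b}, a < b)) ` B \<subseteq> edge_boundary n A \<times> UNIV"
    proof (rule image_subsetI)
      fix p assume p: "p \<in> B"
      obtain \<sigma> a b where pp: "p = (\<sigma>, a, b)"
        by (metis prod_cases3)
      with p have B: "(\<sigma>, a, b) \<in> B" by simp
      define \<rho> where "\<rho> = \<sigma> \<circ> transpose a b"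
      have \<sigma>: "\<sigma> permutes ?V" "\<sigma> \<in> A" and ab: "a \<in> ?V" "b \<in> ?V" and "\<rho> \<notin> A"
        using B perm by (auto simp: B_def \<rho>_def)
      have \<rho>: "\<rho> permutes ?V"
        unfolding \<rho>_def by (intro permutes_compose permutes_swap_id ab \<sigma>)
      \<comment> \<open>Adjacency multiplies on the left, the Laplacian on the right: swapping the
        positions \<open>a\<close>, \<open>b\<close> swaps the values \<open>\<sigma> a\<close>,
        \<open>\<sigma> b\<close>.\<close>
      have "\<rho> \<circ> inv \<sigma> = transpose (\<sigma> a) (\<sigma> b)"
        using permutes_inverses[OF \<sigma>(1)]
        by (auto simp: \<rho>_def fun_eq_iff transpose_def permutes_inv_eq[OF \<sigma>(1)])
      moreover have "\<sigma> a \<noteq> \<sigma> b"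
        using B_neq[OF B] permutes_inj[OF \<sigma>(1)] by (simp add: inj_eq)
      ultimately have "is_transposition n (\<rho> \<circ> inv \<sigma>)"
        using ab \<sigma> permutes_in_image[OF \<sigma>(1)] unfolding is_transposition_def by blast
      then have "{\<rho>, \<sigma>} \<in> transposition_graph_edges n"
        using \<rho> \<sigma> by (auto simp: transposition_graph_edges_def Sym_def)
      then have "{\<sigma>, \<rho>} \<in> edge_boundary n A"
        using \<rho> \<sigma> \<open>\<rho> \<notin> A\<close> by (auto simp: edge_boundary_def Sym_def insert_commute)
      then show "(case p of (\<sigma>, a, b) \<Rightarrow> ({\<sigma>, \<sigma> \<circ> transpose a b}, a < b)) \<in> edge_boundary n A \<times> UNIV"
        by (simp add: pp \<rho>_def)
    qed
  qed (use finE in simp)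
  then have card_B: "card B \<le> 2 * card (edge_boundary n A)"
    by (simp add: card_cartesian_product)
  have "B = Sigma A (\<lambda>\<sigma>. Sigma ?V (\<lambda>a. {b \<in> ?V. \<sigma> \<circ> transpose a b \<notin> A}))"
    by (auto simp: B_def)
  then have "card B = (\<Sum>\<sigma>\<in>A. \<Sum>a\<in>?V. card {b \<in> ?V. \<sigma> \<circ> transpose a b \<notin> A})"
    using finA by simp
  also have "real \<dots> = (\<Sum>\<sigma>\<in>A. \<Sum>a\<in>?V. \<Sum>b\<in>?V. of_bool (\<sigma> \<circ> transpose a b \<notin> A))"
    by (simp add: Int_def)
  also have "\<dots> = (\<Sum>\<sigma>\<in>A. 2 * laplacian ?V f \<sigma>)"
    unfolding laplacian_def f_def by (intro sum.cong) (auto simp: of_bool_def intro!: sum.cong)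
  also have "\<dots> = 2 * (\<Sum>\<sigma>\<in>A. laplacian ?V f \<sigma>)"
    by (simp add: sum_distrib_left)
  also have "(\<Sum>\<sigma>\<in>A. laplacian ?V f \<sigma>) = dot {\<sigma>. \<sigma> permutes ?V} f (laplacian ?V f)"
    unfolding dot_def using perm finP by (intro sum.mono_neutral_cong_left) (auto simp: f_def)
  finally show ?thesis
    using card_B by simp
qed

section \<open>Agreements in large families of bijections\<close>

text \<open>Values outside \<open>D\<close> are pinned to \<open>c\<close>, so that prescribing
  \<open>\<sigma> i = j\<close> yields a set of the same form with \<open>c\<close> updated;
  inductions can then delete one point of \<open>D\<close> and one of \<open>R\<close>.\<close>

definition bijs :: "'a set \<Rightarrow> 'b set \<Rightarrow> ('a \<Rightarrow> 'b) \<Rightarrow> ('a \<Rightarrow> 'b) set" where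
  "bijs D R c = {f. bij_betw f D R \<and> (\<forall>x. x \<notin> D \<longrightarrow> f x = c x)}"

lemma bijs_fiber:
  assumes "i \<in> D" "j \<in> R"
  shows "{\<sigma> \<in> bijs D R c. \<sigma> i = j} = bijs (D - {i}) (R - {j}) (c(i := j))"
proof (intro equalityI subsetI)
  fix \<sigma> assume "\<sigma> \<in> {\<sigma> \<in> bijs D R c. \<sigma> i = j}"
  then have \<sigma>: "bij_betw \<sigma> D R" "\<And>x. x \<notin> D \<Longrightarrow> \<sigma> x = c x" "\<sigma> i = j"
    by (auto simp: bijs_def)
  then have "bij_betw \<sigma> (D - {i}) (R - {j})"
    using assms by (intro bij_betw_DiffI) auto
  then show "\<sigma> \<in> bijs (D - {i}) (R - {j}) (c(i := j))"
    using \<sigma> by (auto simp: bijs_def)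
next
  fix \<sigma> assume "\<sigma> \<in> bijs (D - {i}) (R - {j}) (c(i := j))"
  then have \<sigma>: "bij_betw \<sigma> (D - {i}) (R - {j})" "\<And>x. x \<notin> D - {i} \<Longrightarrow> \<sigma> x = (c(i := j)) x"
    by (auto simp: bijs_def)
  then have "bij_betw \<sigma> ((D - {i}) \<union> {i}) ((R - {j}) \<union> {j})"
    by (intro bij_betw_combine) auto
  then show "\<sigma> \<in> {\<sigma> \<in> bijs D R c. \<sigma> i = j}"
    using assms \<sigma>(2) by (auto simp: bijs_def insert_absorb)
qed

lemma bijs_eq_UN:
  assumes "i \<in> D"
  shows "bijs D R c = (\<Union>j\<in>R. bijs (D - {i}) (R - {j}) (c(i := j)))"
proof -
  have "bijs D R c = (\<Union>j\<in>R. {\<sigma> \<in> bijs D R c. \<sigma> i = j})"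
    using assms by (auto simp: bijs_def bij_betw_def)
  also have "\<dots> = (\<Union>j\<in>R. bijs (D - {i}) (R - {j}) (c(i := j)))"
    using assms by (intro SUP_cong refl bijs_fiber)
  finally show ?thesis .
qed

lemma bijs_fiber_disjoint:
  "j \<noteq> j' \<Longrightarrow> bijs (D - {i}) R (c(i := j)) \<inter> bijs (D - {i}) R' (c(i := j')) = {}"
  by (auto simp: bijs_def)

lemma finite_card_bijs:
  assumes "finite D" "finite R" "card D = card R"
  shows "finite (bijs D R c) \<and> card (bijs D R c) = fact (card D)"
  using assms
proof (induction D arbitrary: R c rule: finite_induct)
  case empty
  then have "bijs {} R c = {c}"
    by (auto simp: bijs_def bij_betw_def)
  then show ?case by simp
next
  case (insert i D)
  let ?F = "\<lambda>j. bijs D (R - {j}) (c(i := j))"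
  have eq: "bijs (insert i D) R c = (\<Union>j\<in>R. ?F j)"
    using bijs_eq_UN[of i "insert i D" R c] insert.hyps by simp
  have F: "finite (?F j) \<and> card (?F j) = fact (card D)" if "j \<in> R" for j
    using that insert.prems insert.hyps by (intro insert.IH) auto
  have disj: "?F j \<inter> ?F j' = {}" if "j \<noteq> j'" for j j'
    using bijs_fiber_disjoint[OF that, of "insert i D" i] insert.hyps by simp
  have "card (\<Union>j\<in>R. ?F j) = (\<Sum>j\<in>R. card (?F j))"
    using insert.prems F disj by (intro card_UN_disjoint) auto
  also have "\<dots> = card R * fact (card D)"
    using F by simp
  also have "\<dots> = fact (card (insert i D))"
    using insert.prems(2) insert.hyps by (simp flip: insert.prems(2))
  finally show ?case
    using insert.prems F by (simp add: eq)
qed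

lemma sum_bijs_fibers:
  assumes "finite D" "finite R" "card D = card R" "i \<in> D"
  shows "(\<Sum>\<sigma>\<in>bijs D R c. g \<sigma>) = (\<Sum>j\<in>R. \<Sum>\<sigma>\<in>bijs (D - {i}) (R - {j}) (c(i := j)). g \<sigma>)"
proof -
  let ?F = "\<lambda>j. bijs (D - {i}) (R - {j}) (c(i := j))"
  have "(\<Sum>\<sigma>\<in>(\<Union>j\<in>R. ?F j). g \<sigma>) = (\<Sum>j\<in>R. \<Sum>\<sigma>\<in>?F j. g \<sigma>)"
  proof (rule sum.UNION_disjoint[OF \<open>finite R\<close>])
    show "\<forall>j\<in>R. finite (?F j)"
      using assms finite_card_bijs[of "D - {i}" "R - {_}"] by simp
    show "\<forall>j\<in>R. \<forall>j'\<in>R. j \<noteq> j' \<longrightarrow> ?F j \<inter> ?F j' = {}"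
      by (intro ballI impI bijs_fiber_disjoint)
  qed
  then show ?thesis
    by (simp only: bijs_eq_UN[OF \<open>i \<in> D\<close>, of R c])
qed

section \<open>An exponential moment bound over all bijections\<close>

text \<open>Each choice of values on \<open>I\<close> extends in at most
  \<open>(card D - card I)!\<close> ways; since \<open>B\<close> is nonnegative, dropping
  injectivity on \<open>I\<close> only enlarges the sum, which then factors into row sums.\<close>

lemma sum_bijs_prod_le:
  fixes B :: "'a \<Rightarrow> 'b \<Rightarrow> real"
  assumes "finite I" "I \<subseteq> D" "finite D" "finite R" "card D = card R"
    and B: "\<And>i j. B i j \<ge> 0"
  shows "(\<Sum>\<sigma>\<in>bijs D R c. \<Prod>i\<in>I. B i (\<sigma> i)) \<le> fact (card D - card I) * (\<Prod>i\<in>I. \<Sum>j\<in>R. B i j)"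
  using assms(1-5)
proof (induction I arbitrary: D R c rule: finite_induct)
  case empty
  then show ?case
    using finite_card_bijs[of D R c] by simp
next
  case (insert i I)
  let ?F = "\<lambda>j. bijs (D - {i}) (R - {j}) (c(i := j))"
  let ?P = "\<lambda>R. \<Prod>i\<in>I. \<Sum>j\<in>R. B i j"
  have "(\<Sum>\<sigma>\<in>?F j. \<Prod>i\<in>insert i I. B i (\<sigma> i)) \<le> B i j * (fact (card D - card (insert i I)) * ?P R)"
    if j: "j \<in> R" for j
  proof -
    have "(\<Sum>\<sigma>\<in>?F j. \<Prod>i\<in>insert i I. B i (\<sigma> i)) = (\<Sum>\<sigma>\<in>?F j. B i j * (\<Prod>i\<in>I. B i (\<sigma> i)))"
      using insert.hyps by (intro sum.cong) (auto simp: bijs_def)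
    also have "\<dots> = B i j * (\<Sum>\<sigma>\<in>?F j. \<Prod>i\<in>I. B i (\<sigma> i))"
      by (simp add: sum_distrib_left)
    also have "\<dots> \<le> B i j * (fact (card (D - {i}) - card I) * ?P (R - {j}))"
      using insert j B by (intro mult_left_mono insert.IH) auto
    also have "\<dots> \<le> B i j * (fact (card D - card (insert i I)) * ?P R)"
    proof (intro mult_left_mono mult_mono prod_mono conjI)
      show "fact (card (D - {i}) - card I) \<le> (fact (card D - card (insert i I)) :: real)"
        using insert by (simp add: card_Diff_singleton)
      show "(\<Sum>j\<in>R - {j}. B k j) \<le> (\<Sum>j\<in>R. B k j)" for k
        using insert.prems B by (intro sum_mono2) auto
    qed (auto intro!: prod_nonneg sum_nonneg B)
    finally show ?thesis .
  qed
  then have "(\<Sum>j\<in>R. \<Sum>\<sigma>\<in>?F j. \<Prod>i\<in>insert i I. B i (\<sigma> i))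
      \<le> (\<Sum>j\<in>R. B i j * (fact (card D - card (insert i I)) * ?P R))"
    by (rule sum_mono)
  then show ?case
    using insert.prems insert.hyps
    by (subst sum_bijs_fibers[where i = i]) (simp_all add: mult_ac flip: sum_distrib_right)
qed

text \<open>The exponential series dominates its term of index \<open>m\<close>.\<close>

lemma power_le_fact_mult_exp: "real m ^ m \<le> fact m * exp (real m)"
proof -
  have "(\<Sum>k\<in>{m}. real m ^ k /\<^sub>R fact k) \<le> (\<Sum>k. real m ^ k /\<^sub>R fact k)"
    using exp_converges[of "real m"] by (intro sum_le_suminf) (auto simp: sums_iff)
  also have "\<dots> = exp (real m)"
    by (simp add: exp_def)
  finally show ?thesis
    by (simp add: field_simps)
qed

text \<open>Equivalently \<open>n! / (n-m)!\<close> is at least \<open>(n/e)^m\<close>, from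
  \<open>(n choose m) \<ge> (n/m)^m\<close> and \<open>m! \<ge> (m/e)^m\<close>.\<close>

lemma fact_diff_le:
  assumes "m \<le> n" "n > 0"
  shows "fact (n - m) \<le> fact n * (exp 1 / real n) ^ m"
proof -
  have "(real n / exp 1) ^ m \<le> real (n choose m) * fact m"
  proof (cases "m = 0")
    case False
    have "(real n / exp 1) ^ m = (real n / real m) ^ m * (real m ^ m / exp (real m))"
      using False by (simp add: power_divide exp_of_nat_mult[symmetric])
    also have "\<dots> \<le> real (n choose m) * fact m"
      using assms power_le_fact_mult_exp[of m]
      by (intro mult_mono binomial_ge_n_over_k_pow_k) (auto simp: field_simps)
    finally show ?thesis .
  qed simp
  then have "(real n / exp 1) ^ m * fact (n - m) \<le> real (n choose m) * fact m * fact (n - m)"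
    by (intro mult_right_mono) auto
  also have "\<dots> = fact n"
    using arg_cong[OF binomial_fact_lemma[OF \<open>m \<le> n\<close>], of real] by (simp add: mult_ac)
  finally show ?thesis
    using \<open>n > 0\<close> by (simp add: field_simps power_divide)
qed

text \<open>Expand over subsets \<open>I\<close> of \<open>D\<close>. Replacing
  \<open>(n - card I)!\<close> by \<open>n! (e/n)^(card I)\<close> lets the expansion fold back into
  a product, as if the values were independent up to a factor \<open>e\<close> in the
  exponent.\<close>

lemma sum_bijs_prod_one_plus_le:
  fixes B :: "'a \<Rightarrow> 'b \<Rightarrow> real"
  assumes "finite D" "finite R" "card D = card R" "D \<noteq> {}"
    and B: "\<And>i j. B i j \<ge> 0"
  shows "(\<Sum>\<sigma>\<in>bijs D R c. \<Prod>i\<in>D. 1 + B i (\<sigma> i))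
    \<le> fact (card D) * exp (exp 1 / card D * (\<Sum>i\<in>D. \<Sum>j\<in>R. B i j))"
proof -
  let ?n = "card D"
  let ?b = "\<lambda>i. \<Sum>j\<in>R. B i j"
  have b: "?b i \<ge> 0" for i
    by (intro sum_nonneg B)
  have "(\<Sum>\<sigma>\<in>bijs D R c. \<Prod>i\<in>D. 1 + B i (\<sigma> i))
      = (\<Sum>\<sigma>\<in>bijs D R c. \<Sum>I\<in>Pow D. \<Prod>i\<in>I. B i (\<sigma> i))"
    using prod_add[OF \<open>finite D\<close>, of "\<lambda>i. B i (_ i)" "\<lambda>_. 1"] by (simp add: add.commute)
  also have "\<dots> = (\<Sum>I\<in>Pow D. \<Sum>\<sigma>\<in>bijs D R c. \<Prod>i\<in>I. B i (\<sigma> i))"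
    by (rule sum.swap)
  also have "\<dots> \<le> (\<Sum>I\<in>Pow D. fact ?n * (\<Prod>i\<in>I. exp 1 / ?n * ?b i))"
  proof (rule sum_mono)
    fix I assume "I \<in> Pow D"
    then have I: "I \<subseteq> D" "finite I" "card I \<le> ?n"
      using \<open>finite D\<close> by (auto intro: finite_subset card_mono)
    have "(\<Sum>\<sigma>\<in>bijs D R c. \<Prod>i\<in>I. B i (\<sigma> i)) \<le> fact (?n - card I) * (\<Prod>i\<in>I. ?b i)"
      using I assms by (intro sum_bijs_prod_le) auto
    also have "\<dots> \<le> fact ?n * (exp 1 / real ?n) ^ card I * (\<Prod>i\<in>I. ?b i)"
      using I assms(1,4) b by (intro mult_right_mono fact_diff_le prod_nonneg) (auto simp: card_gt_0_iff)
    also have "\<dots> = fact ?n * (\<Prod>i\<in>I. exp 1 / ?n * ?b i)"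
      by (simp only: prod.distrib prod_constant mult.assoc)
    finally show "(\<Sum>\<sigma>\<in>bijs D R c. \<Prod>i\<in>I. B i (\<sigma> i)) \<le> fact ?n * (\<Prod>i\<in>I. exp 1 / ?n * ?b i)" .
  qed
  also have "\<dots> = fact ?n * (\<Prod>i\<in>D. 1 + exp 1 / ?n * ?b i)"
    using prod_add[OF \<open>finite D\<close>, of "\<lambda>i. exp 1 / ?n * ?b i" "\<lambda>_. 1"]
    by (simp add: add.commute sum_distrib_left)
  also have "\<dots> \<le> fact ?n * (\<Prod>i\<in>D. exp (exp 1 / ?n * ?b i))"
    using b by (intro mult_left_mono prod_mono) (auto intro!: add_nonneg_nonneg)
  also have "\<dots> = fact ?n * exp (exp 1 / ?n * (\<Sum>i\<in>D. ?b i))"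
    using \<open>finite D\<close> by (simp add: exp_sum sum_distrib_left)
  finally show ?thesis .
qed

lemma sum_fiber_card:
  fixes g :: "'b \<Rightarrow> real"
  assumes "finite A" "finite R" "\<And>\<sigma>. \<sigma> \<in> A \<Longrightarrow> \<sigma> i \<in> R"
  shows "(\<Sum>\<sigma>\<in>A. g (\<sigma> i)) = (\<Sum>j\<in>R. card {\<sigma> \<in> A. \<sigma> i = j} * g j)"
proof -
  have "(\<Sum>\<sigma>\<in>A. g (\<sigma> i)) = (\<Sum>j\<in>R. \<Sum>\<sigma> | \<sigma> \<in> A \<and> \<sigma> i = j. g (\<sigma> i))"
    using assms by (intro sum.group[symmetric]) auto
  then show ?thesis by simp
qed

text \<open>The linear term handles \<open>x \<le> 1\<close>, the quadratic one
  \<open>x > 1\<close>. When applied to fibre densities, the first sums to a known total and the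
  second to the quantity being bounded.\<close>

lemma exp_minus_one_le_quadratic:
  fixes x y :: real
  assumes "0 \<le> x" "x \<le> y"
  shows "exp x - 1 \<le> 2 * x + exp y * x\<^sup>2"
proof (cases "x \<le> 1")
  case True
  then have "exp x - 1 \<le> x + x\<^sup>2"
    using exp_bound[of x] assms by simp
  also have "x\<^sup>2 \<le> x"
    using True assms by (simp add: power2_eq_square mult_left_le)
  finally have "exp x - 1 \<le> 2 * x" by simp
  also have "\<dots> \<le> 2 * x + exp y * x\<^sup>2" by simp
  finally show ?thesis .
next
  case False
  have "exp x \<le> exp y"
    using assms by simp
  then have "exp x - 1 \<le> exp y * 1"
    by linarith
  also have "\<dots> \<le> exp y * x\<^sup>2"
    using False by (intro mult_left_mono) auto
  also have "\<dots> \<le> 2 * x + exp y * x\<^sup>2"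
    using assms by simp
  finally show ?thesis .
qed

text \<open>Divided by \<open>(card A)\<^sup>2\<close>, the sum is the expected number
  \<open>M\<close> of agreements of two independent uniform elements of \<open>A\<close>. The
  exponential moment bounds \<open>M\<close> by a constant plus \<open>M / 2\<close>.\<close>

lemma large_family_fiber_squares:
  fixes D :: "'a set" and R :: "'b set"
  assumes D: "finite D" "finite R" "card D = n" "card R = n"
    and n: "n > 1" "3 * ln n \<le> sqrt n"
    and A: "A \<subseteq> bijs D R c" "fact n \<le> card A * n ^ u"
  shows "(\<Sum>i\<in>D. \<Sum>j\<in>R. (real (card {\<sigma> \<in> A. \<sigma> i = j}))\<^sup>2) \<le> (4 * u + 12) * (real (card A))\<^sup>2"
proof -
  define a where "a = real (card A)"
  define p where "p = (\<lambda>i j. card {\<sigma> \<in> A. \<sigma> i = j} / a)"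
  define l where "l = ln (real n) / 2"
  define M where "M = (\<Sum>i\<in>D. \<Sum>j\<in>R. (p i j)\<^sup>2)"
  have fin_bijs: "finite (bijs D R c)"
    using finite_card_bijs D by metis
  then have finA: "finite A"
    using A finite_subset by blast
  have a: "a > 0"
  proof -
    have "card A \<noteq> 0"
      using A(2) by (intro notI) simp
    then show ?thesis by (simp add: a_def)
  qed
  have "D \<noteq> {}"
    using D n by auto
  have "real (fact n) \<le> real (card A * n ^ u)"
    using A(2) by (simp only: of_nat_le_iff)
  then have fact_le: "fact n \<le> a * real n ^ u"
    by (simp add: a_def)
  have l: "l > 0" and exp_l: "exp l = sqrt n"
    using n by (simp_all add: l_def flip: ln_sqrt)
  have maps: "\<sigma> i \<in> R" if "\<sigma> \<in> A" "i \<in> D" for \<sigma> i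
    using that A by (auto simp: bijs_def bij_betw_def)
  have p: "0 \<le> p i j" "p i j \<le> 1" for i j
    using a finA by (auto simp: p_def a_def card_mono)
  have row: "(\<Sum>j\<in>R. p i j) = 1" if "i \<in> D" for i
    using sum_fiber_card[of A R i "\<lambda>_. 1"] finA D(2) maps that a
    by (simp add: p_def a_def flip: sum_divide_distrib)
  \<comment> \<open>The expected number of agreements of \<sigma> with a random element of
    \<open>A\<close>; its mean over \<open>A\<close> is \<open>M\<close>.\<close>
  define g where "g = (\<lambda>\<sigma>. \<Sum>i\<in>D. p i (\<sigma> i))"
  have mean: "(\<Sum>\<sigma>\<in>A. g \<sigma>) = a * M"
  proof -
    have "(\<Sum>\<sigma>\<in>A. g \<sigma>) = (\<Sum>i\<in>D. \<Sum>\<sigma>\<in>A. p i (\<sigma> i))"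
      unfolding g_def by (rule sum.swap)
    also have "\<dots> = (\<Sum>i\<in>D. \<Sum>j\<in>R. card {\<sigma> \<in> A. \<sigma> i = j} * p i j)"
      using finA D(2) maps by (intro sum.cong refl sum_fiber_card) auto
    also have "\<dots> = a * M"
      using a by (simp add: M_def p_def sum_distrib_left power2_eq_square)
    finally show ?thesis .
  qed
  define B where "B = (\<lambda>i j. exp (l * p i j) - 1)"
  have B: "B i j \<ge> 0" for i j
    using p l by (simp add: B_def)
  \<comment> \<open>Compare the means of \<open>exp (l * g)\<close> over \<open>A\<close>, at least \<open>exp (l * M)\<close> by Jensen, and over all
    bijections. The tilt \<open>l = ln n / 2\<close> makes the density loss \<open>n ^ u\<close> cost only a constant multiple
    of \<open>l\<close>, while cells with \<open>p\<close> near 1 still weigh only \<open>sqrt n\<close>.\<close>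
  have "a * exp (l * M) = (\<Sum>\<sigma>\<in>A. exp (l * M) * (1 + (l * g \<sigma> - l * M)))"
    using mean by (simp add: sum_distrib_left[symmetric] sum.distrib sum_subtractf a_def)
  also have "\<dots> \<le> (\<Sum>\<sigma>\<in>A. exp (l * g \<sigma>))"
  proof (rule sum_mono)
    fix \<sigma>
    have "exp (l * M) * (1 + (l * g \<sigma> - l * M)) \<le> exp (l * M) * exp (l * g \<sigma> - l * M)"
      by (intro mult_left_mono exp_ge_add_one_self) simp
    then show "exp (l * M) * (1 + (l * g \<sigma> - l * M)) \<le> exp (l * g \<sigma>)"
      by (simp flip: exp_add)
  qed
  also have "\<dots> \<le> (\<Sum>\<sigma>\<in>bijs D R c. exp (l * g \<sigma>))"
    using A fin_bijs by (intro sum_mono2) auto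
  also have "\<dots> = (\<Sum>\<sigma>\<in>bijs D R c. \<Prod>i\<in>D. 1 + B i (\<sigma> i))"
    by (simp add: B_def g_def sum_distrib_left exp_sum D)
  also have "\<dots> \<le> fact n * exp (exp 1 / n * (\<Sum>i\<in>D. \<Sum>j\<in>R. B i j))"
    using sum_bijs_prod_one_plus_le[OF D(1,2) _ \<open>D \<noteq> {}\<close>, of B c] B by (simp add: D)
  also have "\<dots> \<le> a * real n ^ u * exp (exp 1 / n * (\<Sum>i\<in>D. \<Sum>j\<in>R. B i j))"
    using fact_le by (rule mult_right_mono) simp
  also have "real n ^ u = exp (2 * u * l)"
    using n by (simp add: l_def exp_of_nat_mult)
  finally have "exp (l * M) \<le> exp (2 * u * l + exp 1 / n * (\<Sum>i\<in>D. \<Sum>j\<in>R. B i j))"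
    using a by (simp add: exp_add)
  then have 1: "l * M \<le> 2 * u * l + exp 1 / n * (\<Sum>i\<in>D. \<Sum>j\<in>R. B i j)"
    by simp
  have "(\<Sum>i\<in>D. \<Sum>j\<in>R. B i j) \<le> (\<Sum>i\<in>D. \<Sum>j\<in>R. 2 * l * p i j + sqrt n * l\<^sup>2 * (p i j)\<^sup>2)"
  proof (intro sum_mono)
    fix i j
    show "B i j \<le> 2 * l * p i j + sqrt n * l\<^sup>2 * (p i j)\<^sup>2"
      using exp_minus_one_le_quadratic[of "l * p i j" l] p[of i j] l
      by (simp add: B_def exp_l power_mult_distrib mult_left_le mult.assoc)
  qed
  also have "\<dots> = 2 * l * n + sqrt n * l\<^sup>2 * M"
    using row D by (simp add: sum.distrib M_def flip: sum_distrib_left)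
  finally have "exp 1 / n * (\<Sum>i\<in>D. \<Sum>j\<in>R. B i j) \<le> 3 / n * (2 * l * n + sqrt n * l\<^sup>2 * M)"
    using B by (intro mult_mono divide_right_mono exp_le sum_nonneg) auto
  also have "\<dots> = 6 * l + 3 * l / sqrt n * l * M"
    using n by (simp add: field_simps power2_eq_square)
  \<comment> \<open>The assumption \<open>3 * ln n \<le> sqrt n\<close> makes the coefficient of
    \<open>l * M\<close> at most one half, so the term can be absorbed on the left.\<close>
  also have "\<dots> \<le> 6 * l + 1 / 2 * l * M"
  proof -
    have "3 * l / sqrt n \<le> 1 / 2"
      using n by (simp add: l_def field_simps)
    moreover have "M \<ge> 0"
      by (simp add: M_def sum_nonneg)
    ultimately show ?thesis
      using l by (intro add_left_mono mult_right_mono) auto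
  qed
  finally have "l * M \<le> l * (4 * u + 12)"
    using 1 by (simp add: algebra_simps)
  then have "M \<le> 4 * u + 12"
    using l by simp
  then have "a\<^sup>2 * M \<le> a\<^sup>2 * (4 * u + 12)"
    by (rule mult_left_mono) simp
  moreover have "a\<^sup>2 * M = (\<Sum>i\<in>D. \<Sum>j\<in>R. (real (card {\<sigma> \<in> A. \<sigma> i = j}))\<^sup>2)"
    using a by (simp add: M_def p_def sum_distrib_left power_divide)
  ultimately show ?thesis
    by (simp add: a_def mult.commute)
qed

section \<open>Binomial moments of the number of agreements\<close>

lemma card_filter_choose_le:
  assumes "finite D" "card D \<le> n"
  shows "real (card {x \<in> D. P x} choose k) \<le> real n ^ k"
proof -
  let ?m = "card {x \<in> D. P x}"
  have "?m choose k \<le> ?m ^ k"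
    using binomial_le_pow[of k ?m] by (cases "k \<le> ?m") (simp_all add: binomial_eq_0)
  also have "?m \<le> card D"
    using assms(1) by (intro card_mono) auto
  then have "?m ^ k \<le> n ^ k"
    using assms(2) by (intro power_mono) auto
  finally show ?thesis
    by (simp flip: of_nat_power)
qed

lemma eventually_three_ln_le_sqrt: "\<forall>\<^sub>F n :: nat in sequentially. 3 * ln n \<le> sqrt n"
proof -
  have "\<forall>\<^sub>F x::real in at_top. ln x / x < 1 / 6"
    using ln_x_over_x_tendsto_0 by (rule order_tendstoD) simp
  then have "\<forall>\<^sub>F n::nat in sequentially. ln (sqrt (real n)) / sqrt (real n) < 1 / 6"
    using filterlim_compose[OF sqrt_at_top filterlim_real_sequentially]
    by (rule eventually_compose_filterlim)
  then show ?thesis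
    using eventually_gt_at_top[of 0]
  proof eventually_elim
    case (elim n)
    then show ?case by (simp add: ln_sqrt field_simps)
  qed
qed

text \<open>Induction on \<open>s\<close>: two elements agreeing at \<open>i\<close> lie in a common
  fibre \<open>\<sigma> i = j\<close>, again a family of bijections on one point fewer. Dense fibres
  satisfy the hypothesis with a larger exponent, hence the arbitrary \<open>u\<close>,
  \<open>D\<close>, \<open>R\<close> and \<open>c\<close>; sparse ones are bounded trivially.
  \<open>large_family_fiber_squares\<close> sums the squared fibre sizes.\<close>

lemma agreement_moment:
  fixes s u :: nat
  shows "\<exists>K\<ge>0. \<exists>N. \<forall>n\<ge>N. \<forall>(D :: 'a set) (R :: 'b set) c A.
    finite D \<longrightarrow> finite R \<longrightarrow> card D = n \<longrightarrow> card R = n \<longrightarrow> A \<subseteq> bijs D R c \<longrightarrow> fact n \<le> card A * n ^ u \<longrightarrow>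
    (\<Sum>\<sigma>\<in>A. \<Sum>\<rho>\<in>A. real (card {x \<in> D. \<sigma> x = \<rho> x} choose s)) \<le> K * (real (card A))\<^sup>2"
proof (induction s arbitrary: u)
  case 0
  show ?case
    by (intro exI[of _ 1] conjI exI[of _ 0]) (simp_all add: power2_eq_square)
next
  case (Suc s)
  \<comment> \<open>A fibre is sparse if it is smaller than \<open>card A / n ^ ?w\<close>; the
    trivial bound \<open>n ^ s\<close> per pair then costs at most
    \<open>(card A)\<^sup>2 / n\<^sup>2\<close> in each of the \<open>n\<^sup>2\<close> cells. Dense
    fibres lose \<open>n ^ (?w + u)\<close>; doubling the exponent expresses this through
    \<open>n - 1\<close>.\<close>
  let ?w = "s + 2"
  obtain K N where K: "K \<ge> 0" and IH: "\<forall>n\<ge>N. \<forall>(D :: 'a set) (R :: 'b set) c A.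
      finite D \<longrightarrow> finite R \<longrightarrow> card D = n \<longrightarrow> card R = n \<longrightarrow> A \<subseteq> bijs D R c \<longrightarrow>
      fact n \<le> card A * n ^ (2 * (?w + u)) \<longrightarrow>
      (\<Sum>\<sigma>\<in>A. \<Sum>\<rho>\<in>A. real (card {x \<in> D. \<sigma> x = \<rho> x} choose s)) \<le> K * (real (card A))\<^sup>2"
    using Suc.IH[of "2 * (?w + u)"] by (elim exE conjE) (rule that)
  obtain N' :: nat where N': "\<And>n::nat. n \<ge> N' \<Longrightarrow> 3 * ln n \<le> sqrt n"
    using eventually_three_ln_le_sqrt by (auto simp: eventually_sequentially)
  \<comment> \<open>The product comes from the dense fibres, the 1 from the sparse ones. Below,
    \<open>n \<ge> 3\<close> ensures \<open>n \<le> (n - 1)\<^sup>2\<close>, and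
    \<open>N + 1\<close> appears because fibres live on \<open>n - 1\<close> points.\<close>
  define K' where "K' = K * (4 * u + 12) + 1"
  have "(\<Sum>\<sigma>\<in>A. \<Sum>\<rho>\<in>A. real (card {x \<in> D. \<sigma> x = \<rho> x} choose Suc s)) \<le> K' * (real (card A))\<^sup>2"
    if n: "n \<ge> max 3 (max (N + 1) N')" and D: "finite D" "finite R" "card D = n" "card R = n"
      and A: "A \<subseteq> bijs D R c" "fact n \<le> card A * n ^ u"
    for n and D :: "'a set" and R :: "'b set" and c A
  proof -
    define F where "F = (\<lambda>i j. {\<sigma> \<in> A. \<sigma> i = j})"
    define h where "h = (\<lambda>i \<sigma> \<rho>. real (card {x \<in> D - {i}. \<sigma> x = (\<rho> x :: 'b)} choose s))"
    have finA: "finite A"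
      using A finite_card_bijs D by (metis finite_subset)
    have maps: "\<sigma> i \<in> R" if "\<sigma> \<in> A" "i \<in> D" for \<sigma> i
      using that A by (auto simp: bijs_def bij_betw_def)
    have pointwise: "real (card {x \<in> D. \<sigma> x = \<rho> x} choose Suc s)
        \<le> (\<Sum>i\<in>D. of_bool (\<sigma> i = \<rho> i) * h i \<sigma> \<rho>)" for \<sigma> \<rho>
    proof -
      let ?E = "{x \<in> D. \<sigma> x = \<rho> x}"
      \<comment> \<open>Each agreeing set of size \<open>Suc s\<close> is counted once for every
        point marked in it.\<close>
      have "card ?E choose Suc s \<le> Suc s * (card ?E choose Suc s)"
        by simp
      also have "\<dots> = card ?E * ((card ?E - 1) choose s)"
        by (rule binomial_absorption)
      finally have "real (card ?E choose Suc s) \<le> (\<Sum>i\<in>?E. real ((card ?E - 1) choose s))"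
        by (simp flip: of_nat_mult)
      also have "\<dots> = (\<Sum>i\<in>?E. h i \<sigma> \<rho>)"
      proof (rule sum.cong[OF refl])
        fix i assume "i \<in> ?E"
        then have "{x \<in> D - {i}. \<sigma> x = \<rho> x} = ?E - {i}" "card (?E - {i}) = card ?E - 1"
          using D by auto
        then show "real ((card ?E - 1) choose s) = h i \<sigma> \<rho>"
          by (simp add: h_def)
      qed
      also have "\<dots> = (\<Sum>i\<in>D. of_bool (\<sigma> i = \<rho> i) * h i \<sigma> \<rho>)"
        using D by (intro sum.mono_neutral_cong_left) auto
      finally show ?thesis .
    qed
    have block: "(\<Sum>\<sigma>\<in>F i j. \<Sum>\<rho>\<in>F i j. h i \<sigma> \<rho>)
        \<le> K * (real (card (F i j)))\<^sup>2 + (real (card A))\<^sup>2 / (real n)\<^sup>2"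
      if i: "i \<in> D" and j: "j \<in> R" for i j
    proof (cases "card A \<le> card (F i j) * n ^ ?w")
      case True
      have "F i j \<subseteq> bijs (D - {i}) (R - {j}) (c(i := j))"
        using A bijs_fiber[OF i j, of c] by (auto simp: F_def)
      moreover have "fact (n - 1) \<le> card (F i j) * (n - 1) ^ (2 * (?w + u))"
      proof -
        have "n * 1 \<le> (n - 1) ^ 2"
        proof -
          obtain m where "n = m + 3" using n by (metis add.commute le_Suc_ex max.bounded_iff)
          then show ?thesis by (simp add: power2_eq_square)
        qed
        have "fact (n - 1) \<le> (fact n :: nat)"
          by (rule fact_mono) simp
        also have "\<dots> \<le> card A * n ^ u" by fact
        also have "\<dots> \<le> (card (F i j) * n ^ ?w) * n ^ u"
          using True by (rule mult_right_mono) simp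
        also have "\<dots> = card (F i j) * n ^ (?w + u)"
          by (simp only: power_add mult.assoc)
        also have "\<dots> \<le> card (F i j) * ((n - 1) ^ 2) ^ (?w + u)"
          using \<open>n * 1 \<le> (n - 1) ^ 2\<close> by (intro mult_left_mono power_mono) auto
        finally show ?thesis
          by (simp only: power_mult)
      qed
      ultimately have "(\<Sum>\<sigma>\<in>F i j. \<Sum>\<rho>\<in>F i j. h i \<sigma> \<rho>) \<le> K * (real (card (F i j)))\<^sup>2"
        unfolding h_def using D i j n by (intro IH[rule_format, of "n - 1"]) auto
      also have "\<dots> \<le> K * (real (card (F i j)))\<^sup>2 + (real (card A))\<^sup>2 / (real n)\<^sup>2"
        by simp
      finally show ?thesis .
    next
      case False
      have "h i \<sigma> \<rho> \<le> real n ^ s" for \<sigma> \<rho>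
        unfolding h_def using D i by (intro card_filter_choose_le) auto
      then have "(\<Sum>\<sigma>\<in>F i j. \<Sum>\<rho>\<in>F i j. h i \<sigma> \<rho>) \<le> (\<Sum>\<sigma>\<in>F i j. \<Sum>\<rho>\<in>F i j. real n ^ s)"
        by (intro sum_mono)
      also have "\<dots> = (real (card (F i j)))\<^sup>2 * real n ^ s"
        by (simp add: power2_eq_square)
      also have "\<dots> \<le> (real (card A))\<^sup>2 / (real n)\<^sup>2"
      proof -
        have "(real (card (F i j)))\<^sup>2 * real n ^ s * (real n)\<^sup>2 = (real (card (F i j)))\<^sup>2 * real n ^ ?w"
          by (simp only: power_add mult.assoc)
        also have "\<dots> \<le> (real (card (F i j)))\<^sup>2 * (real n ^ ?w)\<^sup>2"
          using n by (intro mult_left_mono self_le_power one_le_power) auto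
        also have "\<dots> = (real (card (F i j) * n ^ ?w))\<^sup>2"
          by (simp add: power_mult_distrib)
        also have "\<dots> \<le> (real (card A))\<^sup>2"
          using False by (intro power_mono) (simp_all only: of_nat_le_iff of_nat_0_le_iff)
        finally show ?thesis
          using n by (simp add: field_simps)
      qed
      also have "\<dots> \<le> K * (real (card (F i j)))\<^sup>2 + (real (card A))\<^sup>2 / (real n)\<^sup>2"
        using K by simp
      finally show ?thesis .
    qed
    have "(\<Sum>\<sigma>\<in>A. \<Sum>\<rho>\<in>A. real (card {x \<in> D. \<sigma> x = \<rho> x} choose Suc s))
        \<le> (\<Sum>\<sigma>\<in>A. \<Sum>\<rho>\<in>A. \<Sum>i\<in>D. of_bool (\<sigma> i = \<rho> i) * h i \<sigma> \<rho>)"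
      by (intro sum_mono pointwise)
    also have "\<dots> = (\<Sum>i\<in>D. \<Sum>\<sigma>\<in>A. \<Sum>\<rho>\<in>A. of_bool (\<sigma> i = \<rho> i) * h i \<sigma> \<rho>)"
      by (simp only: sum.swap[of _ D A])
    also have "\<dots> = (\<Sum>i\<in>D. \<Sum>j\<in>R. \<Sum>\<sigma>\<in>F i j. \<Sum>\<rho>\<in>F i j. h i \<sigma> \<rho>)"
    proof (rule sum.cong[OF refl])
      fix i assume i: "i \<in> D"
      have "(\<Sum>\<sigma>\<in>A. \<Sum>\<rho>\<in>A. of_bool (\<sigma> i = \<rho> i) * h i \<sigma> \<rho>) = (\<Sum>\<sigma>\<in>A. \<Sum>\<rho>\<in>F i (\<sigma> i). h i \<sigma> \<rho>)"
        using finA by (intro sum.cong[OF refl] sum.mono_neutral_cong_right) (auto simp: F_def)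
      also have "\<dots> = (\<Sum>j\<in>R. \<Sum>\<sigma> | \<sigma> \<in> A \<and> \<sigma> i = j. \<Sum>\<rho>\<in>F i (\<sigma> i). h i \<sigma> \<rho>)"
        using finA D i maps by (intro sum.group[symmetric]) auto
      also have "\<dots> = (\<Sum>j\<in>R. \<Sum>\<sigma>\<in>F i j. \<Sum>\<rho>\<in>F i j. h i \<sigma> \<rho>)"
        by (intro sum.cong refl) (auto simp: F_def)
      finally show "(\<Sum>\<sigma>\<in>A. \<Sum>\<rho>\<in>A. of_bool (\<sigma> i = \<rho> i) * h i \<sigma> \<rho>)
        = (\<Sum>j\<in>R. \<Sum>\<sigma>\<in>F i j. \<Sum>\<rho>\<in>F i j. h i \<sigma> \<rho>)" .
    qed
    also have "\<dots> \<le> (\<Sum>i\<in>D. \<Sum>j\<in>R. K * (real (card (F i j)))\<^sup>2 + (real (card A))\<^sup>2 / (real n)\<^sup>2)"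
      by (intro sum_mono block)
    also have "\<dots> = K * (\<Sum>i\<in>D. \<Sum>j\<in>R. (real (card (F i j)))\<^sup>2) + (real (card A))\<^sup>2"
      using D n by (simp add: sum.distrib power2_eq_square flip: sum_distrib_left)
    also have "\<dots> \<le> K * ((4 * u + 12) * (real (card A))\<^sup>2) + (real (card A))\<^sup>2"
      using large_family_fiber_squares[OF D _ _ A] N'[of n] n K
      by (intro add_right_mono mult_left_mono) (auto simp: F_def)
    also have "\<dots> = K' * (real (card A))\<^sup>2"
      by (simp add: K'_def algebra_simps)
    finally show ?thesis .
  qed
  moreover have "K' \<ge> 0"
    using K by (simp add: K'_def)
  ultimately show ?case by blast
qed

section \<open>The isoperimetric inequality\<close>

lemma edge_boundary_ge:
  assumes A: "A \<subseteq> Sym n" and t: "t \<ge> 1" "3 * t \<le> n"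
  shows "real (card (edge_boundary n A)) \<ge> real (t * (n - t + 1)) * (real (card A)
    - (\<Sum>\<sigma>\<in>A. \<Sum>\<rho>\<in>A. real (card {x \<in> {1..n}. \<sigma> x = \<rho> x} choose (t - 1))) / fact (n - t + 1))"
proof -
  let ?V = "{1..n}"
  define f :: "(nat \<Rightarrow> nat) \<Rightarrow> real" where "f = (\<lambda>\<sigma>. of_bool (\<sigma> \<in> A))"
  have A': "A \<subseteq> {\<sigma>. \<sigma> permutes ?V}"
    using A by (simp add: Sym_def)
  have fin: "finite {\<sigma>. \<sigma> permutes ?V}"
    by (simp add: finite_permutations)
  have "dot {\<sigma>. \<sigma> permutes ?V} f f = (\<Sum>\<sigma>\<in>A. 1)"
    unfolding dot_def f_def using A' fin by (intro sum.mono_neutral_cong_right) auto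
  then have ff: "dot {\<sigma>. \<sigma> permutes ?V} f f = card A"
    by simp
  have "real (card (edge_boundary n A)) \<ge> dot {\<sigma>. \<sigma> permutes ?V} f (laplacian ?V f)"
    unfolding f_def by (rule dot_laplacian_indicator_le_boundary[OF A])
  moreover have "dot {\<sigma>. \<sigma> permutes ?V} f (laplacian ?V f) \<ge> real (t * (n - t + 1)) * (real (card A)
      - (\<Sum>Z | Z \<subseteq> ?V \<and> card Z = n - t + 1. dot {\<sigma>. \<sigma> permutes ?V} f (avg Z f)))"
    using spectral_bound[of ?V n t f] t unfolding ff by simp
  moreover have "(\<Sum>Z | Z \<subseteq> ?V \<and> card Z = n - t + 1. dot {\<sigma>. \<sigma> permutes ?V} f (avg Z f))
      \<le> (\<Sum>\<sigma>\<in>A. \<Sum>\<rho>\<in>A. real (card {x \<in> ?V. \<sigma> x = \<rho> x} choose (t - 1))) / fact (n - t + 1)"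
  proof -
    have "card ?V - (n - t + 1) = t - 1"
      using t by simp
    then show ?thesis
      unfolding f_def using sum_dot_avg_indicator_le[of ?V A "n - t + 1"] A' t by simp
  qed
  ultimately show ?thesis
    by (meson diff_left_mono mult_left_mono of_nat_0_le_iff order_trans)
qed

lemma fact_le_power_mult_fact:
  assumes "t \<le> n"
  shows "fact n \<le> n ^ t * (fact (n - t) :: nat)"
proof -
  have "fact n = fact n div fact (n - t) * (fact (n - t) :: nat)"
    by (simp add: fact_dvd)
  also have "\<dots> \<le> n ^ t * fact (n - t)"
    using fact_div_fact_le_pow[OF assms] by (rule mult_right_mono) simp
  finally show ?thesis .
qed

text \<open>The bound at level \<open>t + 1\<close> has leading factor \<open>(t+1)(n-t)\<close>,
  which exceeds \<open>t(n-t+1)\<close> by \<open>n - 2t\<close>. For such small \<open>A\<close>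
  its correction is only a proportion \<open>1/n\<close> and fits into this surplus.\<close>

lemma edge_boundary_ge_of_small:
  assumes A: "A \<subseteq> Sym n" and n: "3 * (t + 1) \<le> n" and small: "card A * n ^ (2 * t + 1) < fact n"
  shows "real (card (edge_boundary n A)) \<ge> real (t * (n - t + 1)) * real (card A)"
proof -
  let ?a = "real (card A)"
  have "(\<Sum>\<sigma>\<in>A. \<Sum>\<rho>\<in>A. real (card {x \<in> {1..n}. \<sigma> x = \<rho> x} choose t)) \<le> (\<Sum>\<sigma>\<in>A. \<Sum>\<rho>\<in>A. real n ^ t)"
    by (intro sum_mono card_filter_choose_le) auto
  also have "\<dots> = ?a * ?a * real n ^ t"
    by simp
  \<comment> \<open>The exponent \<open>2 * t + 1\<close> is spent as \<open>t\<close> for the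
    agreements, \<open>t\<close> for passing from \<open>n!\<close> to \<open>(n-t)!\<close>, and 1
    for the gain of \<open>1/n\<close>.\<close>
  also have "\<dots> \<le> ?a * (fact (n - t) / n)"
  proof -
    have "card A * n ^ t * n * n ^ t = card A * n ^ (2 * t + 1)"
      by (simp add: power_add mult_2)
    also have "\<dots> \<le> fact (n - t) * n ^ t"
      using small fact_le_power_mult_fact[of t n] n by (simp add: mult.commute)
    finally have "card A * n ^ t * n \<le> fact (n - t)"
      using n by simp
    then have "real (card A * n ^ t * n) \<le> real (fact (n - t))"
      by (simp only: of_nat_le_iff)
    then have "?a * (?a * real n ^ t * real n) \<le> ?a * fact (n - t)"
      by (intro mult_left_mono) simp_all
    then show ?thesis
      using n by (simp add: field_simps)
  qed
  finally have "(\<Sum>\<sigma>\<in>A. \<Sum>\<rho>\<in>A. real (card {x \<in> {1..n}. \<sigma> x = \<rho> x} choose t)) / fact (n - t) \<le> ?a / n"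
    by (simp add: field_simps)
  then have "real ((t + 1) * (n - t)) * (?a - ?a / n) \<le> real ((t + 1) * (n - t))
      * (?a - (\<Sum>\<sigma>\<in>A. \<Sum>\<rho>\<in>A. real (card {x \<in> {1..n}. \<sigma> x = \<rho> x} choose t)) / fact (n - t))"
    by (intro mult_left_mono diff_left_mono) auto
  also have "\<dots> \<le> real (card (edge_boundary n A))"
    using edge_boundary_ge[OF A, of "t + 1"] n by (simp add: Suc_diff_Suc)
  finally have "real ((t + 1) * (n - t)) * (1 - 1 / n) * ?a \<le> real (card (edge_boundary n A))"
    by (simp add: algebra_simps)
  \<comment> \<open>The loss \<open>(t+1)(n-t)/n\<close> is at most \<open>t + 1\<close>, while the
    surplus \<open>n - 2t\<close> is larger because \<open>3 * (t + 1) \<le> n\<close>.\<close>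
  moreover have "real (t * (n - t + 1)) \<le> real ((t + 1) * (n - t)) * (1 - 1 / n)"
  proof -
    define x where "x = real n - t"
    have x: "x \<ge> 2 * t + 3" "x \<le> n" "real (n - t) = x"
      using n by (simp_all add: x_def of_nat_diff)
    have "(real t + 1) * (x / n) \<le> (real t + 1) * 1"
      using x n by (intro mult_left_mono) auto
    then have "real t * (x + 1) \<le> (real t + 1) * x - (real t + 1) * (x / n)"
      using x(1) by (simp add: algebra_simps)
    then show ?thesis
      by (simp only: of_nat_mult of_nat_add of_nat_1 x(3) right_diff_distrib) simp
  qed
  ultimately show ?thesis
    using mult_right_mono[of _ _ ?a] by (meson of_nat_0_le_iff order_trans)
qed

theorem theorem5p4:
  fixes t :: nat
  shows "\<exists>C::real. C > 0 \<and>
    (\<forall>n\<ge>t. \<forall>A. A \<subseteq> Sym n \<longrightarrow> card A \<le> fact (n - t + 1) \<longrightarrow>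
      real (card (edge_boundary n A)) \<ge>
        (1 - C * (real (card A) / fact (n - t + 1))) * real (t * (n - t + 1)) * real (card A))"
proof (cases "t = 0")
  case True
  then show ?thesis
    by (intro exI[of _ 1]) simp
next
  case False
  obtain K N where K: "K \<ge> 0" and moment: "\<forall>n\<ge>N. \<forall>(D :: nat set) (R :: nat set) c A.
      finite D \<longrightarrow> finite R \<longrightarrow> card D = n \<longrightarrow> card R = n \<longrightarrow> A \<subseteq> bijs D R c \<longrightarrow>
      fact n \<le> card A * n ^ (2 * t + 1) \<longrightarrow>
      (\<Sum>\<sigma>\<in>A. \<Sum>\<rho>\<in>A. real (card {x \<in> D. \<sigma> x = \<rho> x} choose (t - 1))) \<le> K * (real (card A))\<^sup>2"
    using agreement_moment[where s = "t - 1" and u = "2 * t + 1"] by (elim exE conjE) (rule that)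
  \<comment> \<open>From \<open>M\<close> on, both the moment bound and the spectral bound at levels
    \<open>t\<close> and \<open>t + 1\<close> are available.\<close>
  define M where "M = max N (3 * (t + 1))"
  \<comment> \<open>\<open>K\<close> serves the large families; \<open>fact (M + 1)\<close> makes
    the right-hand side nonpositive for nonempty \<open>A\<close> when \<open>n < M\<close>.\<close>
  define C :: real where "C = K + fact (M + 1)"
  have "C > 0"
    using K by (simp add: C_def add_nonneg_pos)
  moreover have "real (card (edge_boundary n A))
      \<ge> (1 - C * (real (card A) / fact (n - t + 1))) * real (t * (n - t + 1)) * real (card A)"
    if "n \<ge> t" and A: "A \<subseteq> Sym n" for n A
  proof -
    let ?a = "real (card A)" and ?F = "fact (n - t + 1) :: real" and ?l = "real (t * (n - t + 1))"
    consider "card A = 0" | "card A > 0" "n < M" | "n \<ge> M" "card A * n ^ (2 * t + 1) < fact n"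
      | "n \<ge> M" "fact n \<le> card A * n ^ (2 * t + 1)"
      by linarith
    then show ?thesis
    proof cases
      case 1
      then show ?thesis by simp
    next
      case 2
      have "?F \<le> fact (M + 1)"
        using 2 by (intro fact_mono) simp
      also have "\<dots> \<le> C"
        using K by (simp add: C_def)
      also have "\<dots> \<le> C * ?a"
        using 2 \<open>C > 0\<close> by simp
      finally have "1 - C * (?a / ?F) \<le> 0"
        by (simp add: le_divide_eq del: fact_Suc)
      then have "(1 - C * (?a / ?F)) * ?l * ?a \<le> 0"
        by (intro mult_nonpos_nonneg) auto
      then show ?thesis by linarith
    next
      case 3
      have "(1 - C * (?a / ?F)) * (?l * ?a) \<le> 1 * (?l * ?a)"
        using \<open>C > 0\<close> by (intro mult_right_mono) auto
      also have "\<dots> \<le> real (card (edge_boundary n A))"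
        using edge_boundary_ge_of_small[OF A _ 3(2)] 3(1) by (simp add: M_def)
      finally show ?thesis
        by (simp only: mult.assoc)
    next
      case 4
      \<comment> \<open>With \<open>c = id\<close>, the pinned values express that points outside
        \<open>{1..n}\<close> are fixed.\<close>
      have "Sym n \<subseteq> bijs {1..n} {1..n} id"
        unfolding Sym_def bijs_def id_apply
        by (intro Collect_mono impI conjI allI) (rule permutes_imp_bij, simp, rule permutes_not_in)
      then have "A \<subseteq> bijs {1..n} {1..n} id"
        using A by (rule order_trans[rotated])
      then have "(\<Sum>\<sigma>\<in>A. \<Sum>\<rho>\<in>A. real (card {x \<in> {1..n}. \<sigma> x = \<rho> x} choose (t - 1))) \<le> K * ?a\<^sup>2"
        using 4 by (intro moment[rule_format, of n]) (auto simp: M_def)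
      also have "\<dots> \<le> C * ?a\<^sup>2"
        by (intro mult_right_mono) (auto simp: C_def)
      finally have "?l * (?a - C * ?a\<^sup>2 / ?F) \<le> ?l * (?a
          - (\<Sum>\<sigma>\<in>A. \<Sum>\<rho>\<in>A. real (card {x \<in> {1..n}. \<sigma> x = \<rho> x} choose (t - 1))) / ?F)"
        by (intro mult_left_mono diff_left_mono divide_right_mono) auto
      also have "\<dots> \<le> real (card (edge_boundary n A))"
        using False 4 by (intro edge_boundary_ge[OF A]) (auto simp: M_def)
      finally show ?thesis
        by (simp add: algebra_simps power2_eq_square)
    qed
  qed
  ultimately show ?thesis by blast
qed

end
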